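(* Let $n\ge 1$ and let $\widetilde X_1,\dots,\widetilde X_n$ be censored observations with endpoints $L_i\le R_i$ (as described in the context). (a) A maximizer $\hat\phi_0$ of $\ell(\cdot,0)$ over $\Phi(0)$ exists if, and only if, there exists no uncensored observation $\widetilde X_{i_o}=\{X_{i_o}\}$ such that each interval $[L_i,R_i]$, $1\le i\le n$, contains $X_{i_o}$. (b) A maximizer $(\hat\phi,\hat q)$ of $\ell(\cdot,\cdot)$ over $\Theta$ exists if, and only if, there exists no uncensored observation $\widetilde X_{i_o}=\{X_{i_o}\}$ such that each interval $[L_i,R_i]$, $1\le i\le n$, contains $X_{i_o}$ or $\infty$.
   Context: Observations: the data $\widetilde X_1,\dots,\widetilde X_n$ are regarded as fixed. For each $i$, either $\widetilde X_i=(L_i,R_i]$ with $-\infty<L_i<R_i\le\infty$ (censored), or $\widetilde X_i=\{X_i\}$ consists of one point $L_i=R_i=X_i\in\mathbb R$ (uncensored). Intervals are subsets of $(-\infty,\infty]$; thus $[L_i,\infty]$ contains $\infty$. Parameter space: $\Theta$ is the set of all pairs $(\phi,q)$ with $q\in[0,1)$ and $\phi:\mathbb R\to[-\infty,\infty)$ concave and upper semicontinuous such that $\int_{\mathbb R} e^{\phi(x)}\,dx+q=1$. For fixed $q$, $\Phi(q)$ is the set of all $\phi$ with $(\phi,q)\in\Theta$. For Borel $B\subset(-\infty,\infty]$, $P_{\phi,q}(B)=\int_{B\cap\mathbb R} e^{\phi(x)}\,dx+1_{[\infty\in B]}\,q$. Normalized log-likelihood $\ell:\Theta\to[-\infty,\infty)$: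 $$\ell(\phi,q)=\frac1n\sum_{i=1}^n\Bigl(1_{[L_i=R_i]}\phi(X_i)+1_{[L_i<R_i]}\log P_{\phi,q}((L_i,R_i])\Bigr),$$ with $\log 0=-\infty$. *)

theory Defs
  imports "HOL-Analysis.Analysis"
begin

definition exp_ereal :: "ereal \<Rightarrow> ennreal" where
  "exp_ereal y = (if y = -\<infinity> then 0 else if y = \<infinity> then \<infinity> else ennreal (exp (real_of_ereal y)))"

definition ln_ennreal :: "ennreal \<Rightarrow> ereal" where
  "ln_ennreal p = (if p = 0 then -\<infinity> else if p = \<infinity> then \<infinity> else ereal (ln (enn2real p)))"

text \<open>
  Only used for functions that do not take the value \<open>\<infinity>\<close>, so that no sum
  \<open>-\<infinity> + \<infinity>\<close> arises.
\<close>
definition concave_ereal :: "(real \<Rightarrow> ereal) \<Rightarrow> bool" where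
  "concave_ereal \<phi> \<longleftrightarrow>
     (\<forall>x y. \<forall>t\<in>{0<..<1}. ereal (1 - t) * \<phi> x + ereal t * \<phi> y \<le> \<phi> ((1 - t) * x + t * y))"

definition upper_semicontinuous :: "(real \<Rightarrow> ereal) \<Rightarrow> bool" where
  "upper_semicontinuous \<phi> \<longleftrightarrow> (\<forall>x. Limsup (at x) \<phi> \<le> \<phi> x)"

definition Theta :: "((real \<Rightarrow> ereal) \<times> real) set" where
  "Theta = {(\<phi>, q). 0 \<le> q \<and> q < 1 \<and> (\<forall>x. \<phi> x \<noteq> \<infinity>) \<and>
     concave_ereal \<phi> \<and> upper_semicontinuous \<phi> \<and>
     (\<integral>\<^sup>+x. exp_ereal (\<phi> x) \<partial>lborel) + ennreal q = 1}"

definition Phi :: "real \<Rightarrow> (real \<Rightarrow> ereal) set" where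
  "Phi q = {\<phi>. (\<phi>, q) \<in> Theta}"

definition P_meas :: "(real \<Rightarrow> ereal) \<Rightarrow> real \<Rightarrow> ereal set \<Rightarrow> ennreal" where
  "P_meas \<phi> q B =
     (\<integral>\<^sup>+x \<in> {x. ereal x \<in> B}. exp_ereal (\<phi> x) \<partial>lborel) + ennreal q * indicator B \<infinity>"

text \<open>
  A left endpoint is always a real number; only the right endpoint of a censored
  observation may be \<open>\<infinity>\<close>.
\<close>
definition censored :: "ereal set \<Rightarrow> real \<Rightarrow> ereal \<Rightarrow> bool" where
  "censored X l r \<longleftrightarrow> ereal l < r \<and> X = {ereal l<..r}"

definition uncensored :: "ereal set \<Rightarrow> real \<Rightarrow> ereal \<Rightarrow> bool" where
  "uncensored X l r \<longleftrightarrow> ereal l = r \<and> X = {ereal l}"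

definition loglik ::
  "nat \<Rightarrow> (nat \<Rightarrow> real) \<Rightarrow> (nat \<Rightarrow> ereal) \<Rightarrow> (real \<Rightarrow> ereal) \<Rightarrow> real \<Rightarrow> ereal" where
  "loglik n L R \<phi> q = ereal (1 / real n) *
     (\<Sum>i=1..n. if ereal (L i) = R i then \<phi> (L i)
                else ln_ennreal (P_meas \<phi> q {ereal (L i)<..R i}))"

end

theory Submission
  imports Defs "HOL-Complex_Analysis.Great_Picard"
begin

text \<open>
  With \<open>f = exp \<phi>\<close> the log-likelihood becomes the logarithm of a product of values and integrals of
  the log-concave density \<open>f\<close>.  Consider a maximizing sequence.  If some observation has a finite
  right end point (otherwise a density to the right of all \<open>L i\<close> is optimal), there are two cases.
  If the densities are uniformly bounded along a subsequence, that observation keeps them away from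
  0 somewhere on a fixed compact interval, log-concavity yields a common exponential envelope, and a
  limit density is a maximizer by dominated convergence.  If their suprema diverge, a density with
  peak height \<open>H\<close> at \<open>m\<close> is at most \<open>H exp (- H d / e)\<close> at distance \<open>d > e / H\<close> from \<open>m\<close>, which
  beats the at most polynomial gain \<open>H ^ n\<close>; so all cells (in part (b), all bounded ones) must touch
  the limit \<open>\<mu>\<close> of the peaks.  This is the excluded situation unless all observations are censored,
  and then a uniform density around \<open>\<mu>\<close> does at least as well as the limit.  Conversely, if an
  uncensored observation touches all cells, uniform densities concentrating at it have unbounded
  likelihood.
\<close>

section \<open>Upper semicontinuous log-concave densities\<close>

definition usc :: "(real \<Rightarrow> real) \<Rightarrow> bool" where
  "usc f \<longleftrightarrow> (\<forall>x c. f x < c \<longrightarrow> (\<forall>\<^sub>F y in nhds x. f y < c))"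

text \<open>Since \<open>0 powr s = 0\<close>, for nonnegative \<open>f\<close> the inequality is
  trivial when \<open>f\<close> vanishes at \<open>x\<close> or \<open>y\<close>; this mirrors the
  value -\<infinity> of a concave log-density.\<close>

definition log_concave :: "(real \<Rightarrow> real) \<Rightarrow> bool" where
  "log_concave f \<longleftrightarrow>
     (\<forall>x y. \<forall>t\<in>{0<..<1}. f x powr (1 - t) * f y powr t \<le> f ((1 - t) * x + t * y))"

lemma usc_borel_measurable:
  assumes "usc f"
  shows "f \<in> borel_measurable borel"
proof (rule borel_measurableI_less)
  fix c
  have "open {x. f x < c}"
    unfolding open_subopen[of "{x. f x < c}"]
    using assms by (auto simp: usc_def eventually_nhds subset_eq)
  then show "{x \<in> space borel. f x < c} \<in> sets borel" by simp
qed

lemma log_concaveD: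
  "log_concave f \<Longrightarrow> 0 < t \<Longrightarrow> t < 1 \<Longrightarrow>
     f x powr (1 - t) * f y powr t \<le> f ((1 - t) * x + t * y)"
  by (auto simp: log_concave_def)

text \<open>A weighted geometric mean is at least the smaller of its two arguments, so log-concavity
  implies quasi-concavity.\<close>

lemma log_concave_min:
  assumes "log_concave f" "\<And>x. 0 \<le> f x" "x \<le> z" "z \<le> y"
  shows "min (f x) (f y) \<le> f z"
proof (cases "x = z \<or> y = z")
  case False
  define t where "t = (z - x) / (y - x)"
  have "t * (y - x) = z - x" using False assms(3,4) by (simp add: t_def)
  then have t: "0 < t" "t < 1" "z = (1 - t) * x + t * y"
    subgoal using False assms(3,4) by (simp add: t_def)
    subgoal using False assms(3,4) by (simp add: t_def)
    subgoal using \<open>t * (y - x) = z - x\<close> by (simp add: algebra_simps)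
    done
  define w where "w = min (f x) (f y)"
  have w: "0 \<le> w" using assms(2) by (simp add: w_def)
  have "w = w powr (1 - t) * w powr t"
    using w by (simp flip: powr_add)
  also have "\<dots> \<le> f x powr (1 - t) * f y powr t"
    using w t by (intro mult_mono powr_mono2) (auto simp: w_def)
  also have "\<dots> \<le> f z" unfolding t(3) by (rule log_concaveD[OF assms(1) t(1,2)])
  finally show ?thesis by (simp add: w_def)
qed auto

text \<open>The analytic counterpart of \<open>Theta\<close>, with \<open>f\<close> in the role of
  \<open>exp \<phi>\<close>; the missing mass \<open>q\<close> sits at the point
  \<infinity>.\<close>

locale subdensity =
  fixes f :: "real \<Rightarrow> real" and q :: real
  assumes nonneg: "0 \<le> f x"
    and lc: "log_concave f"
    and usc: "usc f"
    and integrable: "integrable lborel f"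
    and mass: "integral\<^sup>L lborel f = 1 - q"
    and q_nonneg: "0 \<le> q"
    and q_less: "q < 1"
begin

lemma measurable [measurable]: "f \<in> borel_measurable borel"
  by (rule usc_borel_measurable[OF usc])

lemma set_integrable [simp]: "A \<in> sets borel \<Longrightarrow> set_integrable lborel A f"
  using set_integrable_subset[of lborel UNIV f A] integrable by (simp add: set_integrable_def)

lemma set_integral_nonneg: "0 \<le> (LINT x:A|lborel. f x)"
  unfolding set_lebesgue_integral_def by (rule integral_nonneg_AE) (simp add: nonneg)

lemma set_integral_mono_sets:
  "A \<subseteq> B \<Longrightarrow> A \<in> sets borel \<Longrightarrow> B \<in> sets borel \<Longrightarrow>
     (LINT x:A|lborel. f x) \<le> (LINT x:B|lborel. f x)"
  unfolding set_lebesgue_integral_def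
  by (rule integral_mono)
     (auto simp: nonneg set_integrable[unfolded set_integrable_def] simp del: real_scaleR_def split: split_indicator)

lemma set_integral_le: "A \<in> sets borel \<Longrightarrow> (LINT x:A|lborel. f x) \<le> 1 - q"
  using set_integral_mono_sets[of A UNIV] mass by (simp add: set_lebesgue_integral_def)

lemma interval_mass:
  assumes "a \<le> b" "\<And>x. x \<in> {a..b} \<Longrightarrow> v \<le> f x"
  shows "v * (b - a) \<le> 1 - q"
proof -
  have "v * (b - a) = (LINT x:{a..b}|lborel. v)" using assms(1) by (simp add: set_lebesgue_integral_def)
  also have "\<dots> \<le> (LINT x:{a..b}|lborel. f x)"
    using assms set_integrable[of "{a..b}"]
    by (intro set_integral_mono) (auto simp: set_integrable_def simp del: set_integrable)
  also have "\<dots> \<le> 1 - q" by (rule set_integral_le) simp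
  finally show ?thesis .
qed

text \<open>By quasi-concavity \<open>f\<close> stays above \<open>v\<close> on the whole segment,
  so high values at two distant points cost mass.\<close>

lemma segment_mass:
  assumes "v \<le> f x" "v \<le> f y"
  shows "v * \<bar>x - y\<bar> \<le> 1 - q"
proof -
  have "v \<le> f z" if "z \<in> {min x y..max x y}" for z
    using log_concave_min[OF lc nonneg, of "min x y" z "max x y"] that assms
    by (auto simp: min_def max_def split: if_splits)
  from interval_mass[OF _ this] show ?thesis by (auto simp: min_def max_def abs_if split: if_splits)
qed

text \<open>If the bound failed, then \<open>f > f m / e\<close> on the segment of length \<open>e / f m\<close> from \<open>m\<close>
  towards \<open>x\<close>, which would carry mass greater than 1.\<close>

lemma peak_bound:
  assumes H: "0 < f m" and far: "exp 1 < f m * \<bar>x - m\<bar>"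
  shows "f x \<le> f m * exp (- f m * \<bar>x - m\<bar> / exp 1)"
proof (rule ccontr)
  define H where "H = f m"
  define w where "w = \<bar>x - m\<bar>"
  define t where "t = exp 1 / (H * w)"
  assume "\<not> ?thesis"
  then have fx: "H * exp (- H * w / exp 1) < f x" by (simp add: H_def w_def)
  have Hpos: "0 < H" and Hw: "exp 1 < H * w" using assms by (auto simp: H_def w_def)
  have wpos: "0 < w" using Hpos Hw by (smt (verit) exp_gt_zero zero_less_mult_pos)
  have t: "0 < t" "t < 1" using Hw by (auto simp: t_def Hpos wpos)
  define p where "p = (1 - t) * m + t * x"
  \<comment> \<open>As \<open>t * w = exp 1 / H\<close>, taking the power \<open>t\<close> turns the
    exponential factor into exactly \<open>exp (- 1)\<close>.\<close>
  have "H * exp (- 1) = H powr (1 - t) * (H * exp (- H * w / exp 1)) powr t"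
  proof -
    have "(H * exp (- H * w / exp 1)) powr t = H powr t * exp (- 1)"
      using Hpos wpos by (simp add: powr_mult) (simp add: exp_powr_real t_def)
    then show ?thesis using Hpos by (simp flip: powr_add mult.assoc)
  qed
  also have "\<dots> < H powr (1 - t) * f x powr t"
    using fx t Hpos by (intro mult_strict_left_mono powr_less_mono2) auto
  also have "\<dots> \<le> f p" unfolding p_def H_def by (rule log_concaveD[OF lc t])
  finally have p: "H * exp (- 1) < f p" .
  define v where "v = min (f p) (f m)"
  have v: "H * exp (- 1) < v" using p Hpos by (auto simp: v_def simp flip: H_def)
  have "p - m = t * (x - m)" by (simp add: p_def algebra_simps)
  then have pm: "\<bar>p - m\<bar> = t * w" using t by (simp add: w_def abs_mult)
  have "1 = H * exp (- 1) * (t * w)" using Hpos wpos by (simp add: t_def exp_minus field_simps)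
  also have "\<dots> < v * (t * w)" using v t wpos by (intro mult_strict_right_mono) auto
  also have "\<dots> \<le> 1 - q" using segment_mass[of v p m] pm by (simp add: v_def)
  finally show False using q_nonneg by simp
qed

text \<open>Far from \<open>m\<close> this weakens \<open>peak_bound\<close> by
  \<open>e \<le> f m \<le> C\<close>. Near \<open>m\<close> the exponential is at least
  \<open>exp (- 1)\<close>, which the factor \<open>exp 1\<close> compensates. The envelope depends
  on \<open>f\<close> only through \<open>C\<close>, \<open>e\<close> and \<open>m\<close>.\<close>

lemma tail_bound:
  assumes C: "\<And>x. f x \<le> C" and e: "0 < e" "e \<le> f m"
  shows "f x \<le> C * exp 1 * exp (- e * \<bar>x - m\<bar> / exp 1)"
proof (cases "exp 1 < f m * \<bar>x - m\<bar>")
  case True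
  have "f x \<le> f m * exp (- f m * \<bar>x - m\<bar> / exp 1)"
    using peak_bound[OF _ True] e by simp
  also have "\<dots> \<le> C * exp 1 * exp (- e * \<bar>x - m\<bar> / exp 1)"
  proof (rule mult_mono)
    have "C * 1 \<le> C * exp 1" using C[of m] e by (intro mult_left_mono) auto
    then show "f m \<le> C * exp 1" using C[of m] by simp
  qed (use C[of m] e in \<open>auto simp: divide_right_mono mult_right_mono\<close>)
  finally show ?thesis .
next
  case False
  have "e * \<bar>x - m\<bar> / exp 1 \<le> 1" using False e mult_right_mono[of e "f m" "\<bar>x - m\<bar>"] by simp
  then have "1 \<le> exp 1 * exp (- e * \<bar>x - m\<bar> / exp 1)"
    by (simp flip: exp_add)
  then have "C * 1 \<le> C * (exp 1 * exp (- e * \<bar>x - m\<bar> / exp 1))"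
    using C[of m] e by (intro mult_left_mono) auto
  then show ?thesis using C[of x] by (simp add: mult.assoc)
qed

end

section \<open>Integrals of one-sided and two-sided exponential tails\<close>

lemma nn_integral_exp_tail:
  assumes "0 < a"
  shows "(\<integral>\<^sup>+x. ennreal (exp (- a * x)) * indicator {d..} x \<partial>lborel) = ennreal (exp (- a * d) / a)"
proof -
  have "(\<integral>\<^sup>+x. ennreal (exp (- a * x)) * indicator {d..} x \<partial>lborel) = ennreal (0 - - exp (- a * d) / a)"
  proof (rule nn_integral_FTC_atLeast)
    have "((\<lambda>x. exp (- (a * x))) \<longlongrightarrow> 0) at_top"
      by (intro filterlim_compose[OF exp_at_bot] filterlim_compose[OF filterlim_uminus_at_bot_at_top]
            filterlim_tendsto_pos_mult_at_top[OF tendsto_const assms filterlim_ident])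
    from tendsto_minus[OF tendsto_divide[OF this tendsto_const[of a]]] assms
    show "((\<lambda>x. - exp (- a * x) / a) \<longlongrightarrow> 0) at_top" by simp
  qed (use assms in \<open>auto intro!: derivative_eq_intros\<close>)
  then show ?thesis by simp
qed

text \<open>The two half lines are reduced to the one-sided tail by the substitutions
  \<open>m + x\<close> and \<open>m - x\<close>. The case \<open>d = 0\<close> gives integrability
  on the whole line.\<close>

lemma integral_exp_abs_tail:
  fixes a d m :: real
  assumes a: "0 < a" and d: "0 \<le> d"
  shows "set_integrable lborel {x. d \<le> \<bar>x - m\<bar>} (\<lambda>x. exp (- a * \<bar>x - m\<bar>))" (is "set_integrable _ ?S ?g")
    and "(LINT x:{x. d \<le> \<bar>x - m\<bar>}|lborel. exp (- a * \<bar>x - m\<bar>)) \<le> 2 * exp (- a * d) / a"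
proof -
  have "(\<integral>\<^sup>+x. ennreal (indicator ?S x * ?g x) \<partial>lborel) \<le>
    (\<integral>\<^sup>+x. ennreal (exp (- a * (x - m))) * indicator {d..} (x - m)
        + ennreal (exp (- a * (m - x))) * indicator {d..} (m - x) \<partial>lborel)"
    by (rule nn_integral_mono) (auto simp: indicator_def abs_if)
  also have "\<dots> = (\<integral>\<^sup>+x. ennreal (exp (- a * (x - m))) * indicator {d..} (x - m) \<partial>lborel)
        + (\<integral>\<^sup>+x. ennreal (exp (- a * (m - x))) * indicator {d..} (m - x) \<partial>lborel)"
    by (rule nn_integral_add) auto
  also have "(\<integral>\<^sup>+x. ennreal (exp (- a * (x - m))) * indicator {d..} (x - m) \<partial>lborel) = ennreal (exp (- a * d) / a)"
    using nn_integral_exp_tail[OF a, of d]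
    by (subst nn_integral_real_affine[where c = 1 and t = m]) auto
  also have "(\<integral>\<^sup>+x. ennreal (exp (- a * (m - x))) * indicator {d..} (m - x) \<partial>lborel) = ennreal (exp (- a * d) / a)"
    using nn_integral_exp_tail[OF a, of d]
    by (subst nn_integral_real_affine[where c = "-1" and t = m]) auto
  finally have *: "(\<integral>\<^sup>+x. ennreal (indicator ?S x * ?g x) \<partial>lborel) \<le> ennreal (2 * exp (- a * d) / a)"
    using a by (simp flip: ennreal_plus)
  show 1: "set_integrable lborel ?S ?g"
    unfolding set_integrable_def real_scaleR_def
    by (rule integrableI_bounded) (use * in \<open>auto simp: le_less_trans abs_mult\<close>)
  show "(LINT x:?S|lborel. ?g x) \<le> 2 * exp (- a * d) / a"
    unfolding set_lebesgue_integral_def real_scaleR_def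
    using 1 * a by (subst (asm) nn_integral_eq_integral) (auto simp: set_integrable_def)
qed

text \<open>Integration of \<open>peak_bound\<close> outside the \<open>d\<close>-neighbourhood of
  \<open>m\<close>; the height \<open>f m\<close> cancels against the decay rate
  \<open>a = f m / exp 1\<close>.\<close>

lemma (in subdensity) peak_tail_mass:
  assumes d: "exp 1 < f m * d"  and d0: "0 < d"
  shows "(LINT x:{x. d \<le> \<bar>x - m\<bar>}|lborel. f x) \<le> 2 * exp 1 * exp (- f m * d / exp 1)"
proof -
  let ?S = "{x. d \<le> \<bar>x - m\<bar>}"
  define a where "a = f m / exp 1"
  have H: "0 < f m" using d d0 by (smt (verit) exp_gt_zero zero_less_mult_pos2)
  have a: "0 < a" using H by (simp add: a_def)
  note I = integral_exp_abs_tail[OF a less_imp_le[OF d0], of m]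
  have "(LINT x:?S|lborel. f x) \<le> (LINT x:?S|lborel. f m * exp (- a * \<bar>x - m\<bar>))"
  proof (rule set_integral_mono)
    fix x assume "x \<in> ?S"
    then have "f m * d \<le> f m * \<bar>x - m\<bar>" using H by simp
    with d have "exp 1 < f m * \<bar>x - m\<bar>" by simp
    from peak_bound[OF H this] show "f x \<le> f m * exp (- a * \<bar>x - m\<bar>)" by (simp add: a_def)
  qed (use I in auto)
  also have "\<dots> = f m * (LINT x:?S|lborel. exp (- a * \<bar>x - m\<bar>))" by simp
  also have "\<dots> \<le> f m * (2 * exp (- a * d) / a)" using I H by (intro mult_left_mono) auto
  also have "\<dots> = 2 * exp 1 * exp (- f m * d / exp 1)" using H by (simp add: a_def)
  finally show ?thesis .
qed

section \<open>Selection of a convergent subsequence\<close>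

text \<open>Upper semicontinuity gives no lower bounds near \<open>x\<close>. Log-concavity does, on
  the segment towards any point of positive value, because
  \<open>g x powr (1 - t) * g u powr t\<close> tends to \<open>g x\<close> as \<open>t\<close>
  decreases to 0.\<close>

lemma log_concave_near:
  assumes lc: "log_concave g" and gu: "0 < g u" and c: "c < g x" and gx: "0 < g x"
  obtains t where "0 < t" "t < 1" "c < g ((1 - t) * x + t * u)"
proof -
  have "((\<lambda>t. g x powr (1 - t) * g u powr t) \<longlongrightarrow> g x powr (1 - 0) * g u powr 0) (at_right 0)"
    using gu gx by (intro tendsto_intros) auto
  then have "\<forall>\<^sub>F t in at_right 0. c < g x powr (1 - t) * g u powr t"
    using c gu gx by (intro order_tendstoD(1)) auto
  moreover have "\<forall>\<^sub>F t in at_right (0::real). 0 < t \<and> t < 1"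
    by (auto simp: eventually_at_right[of 0 1] intro!: exI[of _ 1])
  ultimately have "\<forall>\<^sub>F t in at_right 0. 0 < t \<and> t < 1 \<and> c < g ((1 - t) * x + t * u)"
    by eventually_elim (use log_concaveD[OF lc] less_le_trans in blast)
  then obtain t where "0 < t \<and> t < 1 \<and> c < g ((1 - t) * x + t * u)"
    using eventually_happens[of _ "at_right (0::real)"] by auto
  then show thesis using that by blast
qed

lemma rational_interval_around:
  fixes x e :: real
  assumes "0 < e"
  obtains u v where "u \<in> \<rat>" "v \<in> \<rat>" "x - e < u" "u < x" "x < v" "v < x + e"
  using Rats_dense_in_real[of "x - e" x] Rats_dense_in_real[of x "x + e"] assms
  by (metis add.commute diff_less_eq less_add_same_cancel1)

text \<open>The limit is the hypograph limit: along a subsequence, the suprema over all intervals with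
  rational end points converge, and \<open>g x\<close> is the infimum of these limits over the intervals around
  \<open>x\<close>.  This makes \<open>g\<close> upper semicontinuous without any further regularisation.\<close>

lemma log_concave_selection:
  fixes f :: "nat \<Rightarrow> real \<Rightarrow> real"
  assumes lc: "\<And>k. log_concave (f k)" and nonneg: "\<And>k x. 0 \<le> f k x" and bound: "\<And>k x. f k x \<le> C"
  obtains r :: "nat \<Rightarrow> nat" and g N where "strict_mono r" "\<And>x. 0 \<le> g x" "log_concave g" "usc g"
    "\<And>x c. g x < c \<Longrightarrow> \<forall>\<^sub>F k in sequentially. f (r k) x < c"
    "finite N" "\<And>x. x \<notin> N \<Longrightarrow> (\<lambda>k. f (r k) x) \<longlonglongrightarrow> g x"
proof -
  define S where "S = {(u, v). u \<in> \<rat> \<and> v \<in> \<rat> \<and> (u::real) < v}"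
  define iv where "iv J = {fst J<..<snd J}" for J :: "real \<times> real"
  define s where "s k J = Sup (f k ` iv J)" for k J
  have "countable S"
    by (rule countable_subset[of _ "\<rat> \<times> \<rat>"]) (auto simp: S_def intro: countable_rat)
  have iv_ne: "iv J \<noteq> {}" if "J \<in> S" for J
    using that dense by (auto simp: S_def iv_def)
  have bdd: "bdd_above (f k ` iv J)" for k J
    by (rule bdd_aboveI[of _ C]) (use bound in auto)
  have le_s: "f k x \<le> s k J" if "x \<in> iv J" for k x J
    unfolding s_def using that bdd by (intro cSup_upper) auto
  have s_nonneg: "0 \<le> s k J" if J: "J \<in> S" for k J
  proof -
    obtain x where "x \<in> iv J" using iv_ne[OF J] by blast
    then show ?thesis using le_s nonneg order_trans by blast
  qed
  have s_le: "s k J \<le> C" if J: "J \<in> S" for k J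
    unfolding s_def using iv_ne[OF J] bound by (intro cSup_least) auto
  \<comment> \<open>Diagonal argument over the countably many rational intervals; the suprema all
    lie between 0 and \<open>C\<close>.\<close>
  obtain r where r: "strict_mono r" and conv: "\<And>J. J \<in> S \<Longrightarrow> \<exists>l. (\<lambda>k. s (r k) J) \<longlonglongrightarrow> l"
    by (rule function_convergent_subsequence[OF \<open>countable S\<close>, of s C]) (use s_nonneg s_le in auto)
  define l where "l J = lim (\<lambda>k. s (r k) J)" for J
  have lim: "(\<lambda>k. s (r k) J) \<longlonglongrightarrow> l J" if "J \<in> S" for J
    using conv[OF that] by (auto simp: l_def limI)
  have l_nonneg: "0 \<le> l J" if "J \<in> S" for J
    using lim[OF that] s_nonneg[OF that] by (intro LIMSEQ_le_const) auto
  define g where "g x = Inf (l ` {J \<in> S. x \<in> iv J})" for x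
  have small: "\<exists>J\<in>S. x \<in> iv J \<and> iv J \<subseteq> {x - e<..<x + e}" if "0 < e" for x e
  proof -
    obtain u v where "u \<in> \<rat>" "v \<in> \<rat>" "x - e < u" "u < x" "x < v" "v < x + e"
      using rational_interval_around[OF \<open>0 < e\<close>] .
    then show ?thesis by (intro bexI[of _ "(u, v)"]) (auto simp: S_def iv_def)
  qed
  have ne: "{J \<in> S. x \<in> iv J} \<noteq> {}" for x
    using small[of 1 x] by auto
  have g_le: "g x \<le> l J" if "J \<in> S" "x \<in> iv J" for x J
    unfolding g_def using that l_nonneg by (intro cInf_lower) (auto intro: bdd_belowI[of _ 0])
  have le_g: "c \<le> g x" if "\<And>J. J \<in> S \<Longrightarrow> x \<in> iv J \<Longrightarrow> c \<le> l J" for x c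
    unfolding g_def using ne that by (intro cInf_greatest) auto
  have g_less: "\<exists>J\<in>S. x \<in> iv J \<and> l J < c" if "g x < c" for x c
    using that ne[of x] cInf_lessD[of "l ` {J \<in> S. x \<in> iv J}" c] unfolding g_def by auto
  have g_nonneg: "0 \<le> g x" for x
    using le_g l_nonneg by blast
  have "usc g"
    unfolding usc_def
  proof (intro allI impI)
    fix x c assume "g x < c"
    then obtain J where J: "J \<in> S" "x \<in> iv J" "l J < c" using g_less by blast
    have "\<forall>\<^sub>F y in nhds x. y \<in> iv J"
      using J(2) by (intro eventually_nhds_in_open) (auto simp: iv_def)
    then show "\<forall>\<^sub>F y in nhds x. g y < c"
      by eventually_elim (use g_le J in \<open>meson le_less_trans\<close>)
  qed
  have upper: "\<forall>\<^sub>F k in sequentially. f (r k) x < c" if less: "g x < c" for x c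
  proof -
    obtain J where J: "J \<in> S" "x \<in> iv J" "l J < c" using g_less[OF less] by blast
    have "\<forall>\<^sub>F k in sequentially. s (r k) J < c" using order_tendstoD(2)[OF lim] J by blast
    then show ?thesis by eventually_elim (use le_s[OF J(2)] in \<open>meson le_less_trans\<close>)
  qed
  \<comment> \<open>The lower bound holds only at some point near \<open>x\<close> that varies with
    \<open>k\<close>. Log-concavity must later carry it over to a fixed point.\<close>
  have lower: "\<forall>\<^sub>F k in sequentially. \<exists>y\<in>iv J. c < f (r k) y" if "J \<in> S" "x \<in> iv J" "c < g x" for J x c
  proof -
    have "c < l J" using g_le that by (meson less_le_trans)
    then have "\<forall>\<^sub>F k in sequentially. c < s (r k) J" using order_tendstoD(1)[OF lim] that by blast
    then show ?thesis
    proof eventually_elim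
      case (elim k)
      then show ?case using less_cSupD[of "f (r k) ` iv J" c] iv_ne[OF that(1)] by (auto simp: s_def)
    qed
  qed
  have lcg: "log_concave g"
    unfolding log_concave_def
  proof (intro allI ballI le_g)
    fix x y t J assume t: "t \<in> {0<..<1::real}" and J: "J \<in> S" "(1 - t) * x + t * y \<in> iv J"
    show "g x powr (1 - t) * g y powr t \<le> l J"
    proof (cases "g x = 0 \<or> g y = 0")
      case True
      then show ?thesis using l_nonneg[OF J(1)] by auto
    next
      case False
      then have pos: "0 < g x" "0 < g y" using g_nonneg by (auto simp: order_less_le)
      define z where "z = (1 - t) * x + t * y"
      \<comment> \<open>The margin of \<open>z\<close> inside \<open>J\<close>: convex combinations
        of points within \<open>e\<close> of \<open>x\<close> and \<open>y\<close> remain in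
        \<open>J\<close>.\<close>
      define e where "e = min (z - fst J) (snd J - z)"
      have "0 < e" using J by (auto simp: e_def z_def iv_def)
      obtain Jx where Jx: "Jx \<in> S" "x \<in> iv Jx" "iv Jx \<subseteq> {x - e<..<x + e}" using small \<open>0 < e\<close> by blast
      obtain Jy where Jy: "Jy \<in> S" "y \<in> iv Jy" "iv Jy \<subseteq> {y - e<..<y + e}" using small \<open>0 < e\<close> by blast
      have in_J: "(1 - t) * x' + t * y' \<in> iv J" if "x' \<in> iv Jx" "y' \<in> iv Jy" for x' y'
      proof -
        have "\<bar>x' - x\<bar> < e" "\<bar>y' - y\<bar> < e" using that Jx Jy by (auto simp: abs_less_iff)
        then have "(1 - t) * \<bar>x' - x\<bar> + t * \<bar>y' - y\<bar> < e"
          using t by (intro convex_bound_lt) auto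
        then have "\<bar>(1 - t) * (x' - x) + t * (y' - y)\<bar> < e"
          using t abs_triangle_ineq[of "(1 - t) * (x' - x)" "t * (y' - y)"] by (simp add: abs_mult)
        moreover have "(1 - t) * x' + t * y' - z = (1 - t) * (x' - x) + t * (y' - y)"
          by (simp add: z_def algebra_simps)
        ultimately show ?thesis by (auto simp: e_def iv_def abs_less_iff)
      qed
      show ?thesis
      proof (rule field_le_mult_one_interval)
        \<comment> \<open>Shrinking both values by \<sigma> produces the strict inequalities that
          \<open>lower\<close> requires; the powers of \<sigma> recombine to \<sigma>
          itself.\<close>
        fix \<sigma> :: real assume \<sigma>: "0 < \<sigma>" "\<sigma> < 1"
        have "\<forall>\<^sub>F k in sequentially. \<exists>x'\<in>iv Jx. \<sigma> * g x < f (r k) x'"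
          using lower[OF Jx(1,2)] \<sigma> pos by simp
        moreover have "\<forall>\<^sub>F k in sequentially. \<exists>y'\<in>iv Jy. \<sigma> * g y < f (r k) y'"
          using lower[OF Jy(1,2)] \<sigma> pos by simp
        ultimately have "\<forall>\<^sub>F k in sequentially. \<sigma> * (g x powr (1 - t) * g y powr t) \<le> s (r k) J"
        proof eventually_elim
          case (elim k)
          then obtain x' y' where *: "x' \<in> iv Jx" "\<sigma> * g x < f (r k) x'"
            "y' \<in> iv Jy" "\<sigma> * g y < f (r k) y'" by blast
          have "\<sigma> * (g x powr (1 - t) * g y powr t) = (\<sigma> * g x) powr (1 - t) * (\<sigma> * g y) powr t"
            using \<sigma> pos by (simp add: powr_mult powr_diff field_simps)
          also have "\<dots> \<le> f (r k) x' powr (1 - t) * f (r k) y' powr t"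
            using * \<sigma> pos t by (intro mult_mono powr_mono2) auto
          also have "\<dots> \<le> f (r k) ((1 - t) * x' + t * y')"
            using t by (intro log_concaveD lc) auto
          also have "\<dots> \<le> s (r k) J" using * by (intro le_s in_J)
          finally show ?case .
        qed
        then show "\<sigma> * (g x powr (1 - t) * g y powr t) \<le> l J"
          by (rule tendsto_lowerbound[OF lim[OF J(1)]]) simp
      qed
    qed
  qed
  \<comment> \<open>The end points of the support at which \<open>g\<close> is positive, at most one
    on each side. There the support of \<open>f (r k)\<close> may approach the point from inside,
    and pointwise convergence may fail.\<close>
  define N where "N = {x. 0 < g x \<and> (\<forall>u<x. g u = 0)} \<union> {x. 0 < g x \<and> (\<forall>u>x. g u = 0)}"
  have "finite N"
  proof -
    have fin: "finite A" if "\<And>x y. x \<in> A \<Longrightarrow> y \<in> A \<Longrightarrow> x = y" for A :: "real set"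
      using that by (metis finite.simps is_singletonI' is_singleton_the_elem)
    show ?thesis unfolding N_def
    proof (intro finite_UnI fin)
      fix x y assume "x \<in> {x. 0 < g x \<and> (\<forall>u<x. g u = 0)}" "y \<in> {x. 0 < g x \<and> (\<forall>u<x. g u = 0)}"
      then show "x = y" by (cases x y rule: linorder_cases) auto
    next
      fix x y assume "x \<in> {x. 0 < g x \<and> (\<forall>u>x. g u = 0)}" "y \<in> {x. 0 < g x \<and> (\<forall>u>x. g u = 0)}"
      then show "x = y" by (cases x y rule: linorder_cases) auto
    qed
  qed
  have "(\<lambda>k. f (r k) x) \<longlonglongrightarrow> g x" if x: "x \<notin> N" for x
  proof (rule order_tendstoI)
    fix c assume c: "c < g x"
    show "\<forall>\<^sub>F k in sequentially. c < f (r k) x"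
    proof (cases "g x = 0")
      case True
      then have "c < f (r k) x" for k using c nonneg[of "r k" x] by linarith
      then show ?thesis by simp
    next
      case False
      then have pos: "0 < g x" using g_nonneg by (auto simp: order_less_le)
      obtain u v where uv: "u < x" "0 < g u" "x < v" "0 < g v"
        using x pos g_nonneg unfolding N_def by (auto simp: order_less_le)
      obtain t where t: "0 < t" "t < 1" "c < g ((1 - t) * x + t * u)"
        using log_concave_near[OF lcg uv(2) c pos] .
      obtain t' where t': "0 < t'" "t' < 1" "c < g ((1 - t') * x + t' * v)"
        using log_concave_near[OF lcg uv(4) c pos] .
      \<comment> \<open>Points on both sides of \<open>x\<close> with \<open>g\<close> above
        \<open>c\<close>. The intervals around them are too short to reach \<open>x\<close>, so
        quasi-concavity of \<open>f (r k)\<close> transfers the bound \<open>c\<close> to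
        \<open>x\<close>.\<close>
      define u' where "u' = (1 - t) * x + t * u"
      define v' where "v' = (1 - t') * x + t' * v"
      have u': "u' < x" using t uv by (simp add: u'_def algebra_simps)
      have v': "x < v'" using t' uv by (simp add: v'_def algebra_simps)
      obtain Ju where Ju: "Ju \<in> S" "u' \<in> iv Ju" "iv Ju \<subseteq> {u' - (x - u')<..<u' + (x - u')}"
        using small[of "x - u'" u'] u' by auto
      obtain Jv where Jv: "Jv \<in> S" "v' \<in> iv Jv" "iv Jv \<subseteq> {v' - (v' - x)<..<v' + (v' - x)}"
        using small[of "v' - x" v'] v' by auto
      have "\<forall>\<^sub>F k in sequentially. \<exists>y\<in>iv Ju. c < f (r k) y" using lower[OF Ju(1,2)] t by (simp add: u'_def)
      moreover have "\<forall>\<^sub>F k in sequentially. \<exists>y\<in>iv Jv. c < f (r k) y" using lower[OF Jv(1,2)] t' by (simp add: v'_def)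
      ultimately show ?thesis
      proof eventually_elim
        case (elim k)
        then obtain y z where yz: "y \<in> iv Ju" "c < f (r k) y" "z \<in> iv Jv" "c < f (r k) z" by blast
        then have "y < x" "x < z" using Ju Jv by auto
        then have "min (f (r k) y) (f (r k) z) \<le> f (r k) x"
          by (intro log_concave_min lc nonneg) auto
        then show ?case using yz by linarith
      qed
    qed
  qed (rule upper)
  then show thesis using that[OF r g_nonneg lcg \<open>usc g\<close> upper \<open>finite N\<close>] by blast
qed

section \<open>Likelihoods and bounded sequences\<close>

lemma subdensity_uniform:
  fixes a b q :: real
  assumes ab: "a < b" and q: "0 \<le> q" "q < 1"
  shows "subdensity (\<lambda>x. indicator {a..b} x * ((1 - q) / (b - a))) q" (is "subdensity ?f q")
proof
  let ?v = "(1 - q) / (b - a)"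
  have v: "0 < ?v" using ab q by simp
  show "log_concave ?f"
    unfolding log_concave_def
  proof (intro allI ballI)
    fix x y t :: real assume t: "t \<in> {0<..<1}"
    show "?f x powr (1 - t) * ?f y powr t \<le> ?f ((1 - t) * x + t * y)"
    proof (cases "x \<in> {a..b} \<and> y \<in> {a..b}")
      case True
      then have "(1 - t) * x + t * y \<in> {a..b}"
        using t convexD[OF convex_real_interval(5)[of a b], of x y "1 - t" t] by simp
      then show ?thesis using True v by (simp flip: powr_add)
    next
      case False
      then show ?thesis using v less_imp_le[OF ab] q by (auto simp: indicator_def)
    qed
  qed
  show "usc ?f"
    unfolding usc_def
  proof (intro allI impI)
    fix x c assume c: "?f x < c"
    show "\<forall>\<^sub>F y in nhds x. ?f y < c"
    proof (cases "x \<in> {a..b}")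
      case True
      then have "?v < c" "0 < c" using c v by auto
      then show ?thesis by (intro always_eventually) (auto simp: indicator_def)
    next
      case False
      have "\<forall>\<^sub>F y in nhds x. y \<in> - {a..b}"
        using False by (intro eventually_nhds_in_open) auto
      then show ?thesis by eventually_elim (use False c in auto)
    qed
  qed
  show "integral\<^sup>L lborel ?f = 1 - q" using ab by simp
qed (use assms in auto)

lemma uniform_mass_ge:
  fixes a b c d q :: real
  assumes ab: "a < b" and q: "0 \<le> q" "q < 1" and cd: "c \<le> d" "a \<le> c" "d \<le> b"
    and A: "A \<in> sets borel" "{c<..d} \<subseteq> A"
  shows "(d - c) * ((1 - q) / (b - a)) \<le> (LINT x:A|lborel. indicator {a..b} x * ((1 - q) / (b - a)))"
proof -
  interpret subdensity "\<lambda>x. indicator {a..b} x * ((1 - q) / (b - a))" q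
    by (rule subdensity_uniform[OF ab q])
  have "(d - c) * ((1 - q) / (b - a)) = (LINT x:{c<..d}|lborel. (1 - q) / (b - a))"
    using cd by (simp add: set_lebesgue_integral_def)
  also have "\<dots> = (LINT x:{c<..d}|lborel. indicator {a..b} x * ((1 - q) / (b - a)))"
    using cd by (intro set_lebesgue_integral_cong) auto
  also have "\<dots> \<le> (LINT x:A|lborel. indicator {a..b} x * ((1 - q) / (b - a)))"
    using A by (intro set_integral_mono_sets) auto
  finally show ?thesis .
qed

text \<open>The feasible values of \<open>q\<close> are \<open>Q = {0}\<close> in part (a) and \<open>Q = {0..<1}\<close> in part (b).\<close>

locale censored_sample =
  fixes n :: nat and L :: "nat \<Rightarrow> real" and R :: "nat \<Rightarrow> ereal" and Q :: "real set"
  assumes n_pos: "n \<ge> 1"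
    and L_le_R: "i \<in> {1..n} \<Longrightarrow> ereal (L i) \<le> R i"
    and Q: "Q = {0} \<or> Q = {0..<1}"
begin

text \<open>Only the real part of an observation interval; \<open>factor\<close> accounts for a
  possible point \<infinity> through \<open>q\<close>.\<close>

definition cell :: "nat \<Rightarrow> real set" where
  "cell i = {x. ereal (L i) < ereal x \<and> ereal x \<le> R i}"

definition factor :: "nat \<Rightarrow> (real \<Rightarrow> real) \<Rightarrow> real \<Rightarrow> real" where
  "factor i f q = (if ereal (L i) = R i then f (L i)
     else (LINT x:cell i|lborel. f x) + (if R i = \<infinity> then q else 0))"

definition lik :: "(real \<Rightarrow> real) \<Rightarrow> real \<Rightarrow> real" where
  "lik f q = (\<Prod>i=1..n. factor i f q)"

text \<open>One condition for both parts: reaching \<infinity> counts as a substitute for containing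
  \<open>x\<close> exactly when mass at \<infinity> is allowed, that is for
  \<open>Q \<noteq> {0}\<close>.\<close>

definition covering :: "real \<Rightarrow> bool" where
  "covering x \<longleftrightarrow> (\<forall>i\<in>{1..n}. ereal x \<in> {ereal (L i)..R i} \<or> (Q \<noteq> {0} \<and> R i = \<infinity>))"

definition degenerate :: bool where
  "degenerate \<longleftrightarrow> (\<exists>j\<in>{1..n}. ereal (L j) = R j \<and> covering (L j))"

lemma cell_borel [measurable, simp]: "cell i \<in> sets borel"
  unfolding cell_def by measurable

lemma Q_bounds: "q \<in> Q \<Longrightarrow> 0 \<le> q" "q \<in> Q \<Longrightarrow> q < 1" "0 \<in> Q"
  using Q by auto

lemma R_cases:
  assumes "i \<in> {1..n}"
  obtains "R i = \<infinity>" | B where "R i = ereal B" "L i \<le> B"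
  using L_le_R[OF assms] by (cases "R i") auto

lemma factor_nonneg: "subdensity f q \<Longrightarrow> 0 \<le> factor i f q"
  by (simp add: factor_def subdensity.nonneg subdensity.set_integral_nonneg subdensity.q_nonneg)

lemma factor_le:
  assumes "subdensity f q" "1 \<le> C" "ereal (L i) = R i \<Longrightarrow> f (L i) \<le> C"
  shows "factor i f q \<le> C"
  using subdensity.set_integral_le[OF assms(1), of "cell i"] subdensity.q_nonneg[OF assms(1)]
    assms(2,3) by (auto simp: factor_def)

lemma factor_le_mass:
  assumes "subdensity f q" "ereal (L i) \<noteq> R i" "R i \<noteq> \<infinity>"
  shows "factor i f q \<le> 1 - q"
  using subdensity.set_integral_le[OF assms(1), of "cell i"] assms(2,3) by (auto simp: factor_def)

text \<open>All other factors are at most \<open>C\<close>. Hence one tiny factor makes the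
  likelihood small, and a positive lower bound on the likelihood passes to every single
  factor.\<close>

lemma lik_le_factor:
  assumes "subdensity f q" "1 \<le> C" "\<And>i. i \<in> {1..n} \<Longrightarrow> ereal (L i) = R i \<Longrightarrow> f (L i) \<le> C"
    and j: "j \<in> {1..n}"
  shows "lik f q \<le> factor j f q * C ^ (n - 1)"
proof -
  have "(\<Prod>i\<in>{1..n} - {j}. factor i f q) \<le> (\<Prod>i\<in>{1..n} - {j}. C)"
    using assms by (intro prod_mono conjI factor_nonneg factor_le) auto
  also have "\<dots> = C ^ (n - 1)" using j by simp
  finally have "factor j f q * (\<Prod>i\<in>{1..n} - {j}. factor i f q) \<le> factor j f q * C ^ (n - 1)"
    by (intro mult_left_mono factor_nonneg[OF assms(1)])
  then show ?thesis unfolding lik_def using j by (simp add: prod.remove)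
qed

text \<open>A point value of \<open>f\<close>, or its mean over the cell, cannot exceed all values
  of \<open>f\<close> there. The denominator is at least 1 and exceeds the cell length, so it serves
  both cases.\<close>

lemma exists_value_in_cell:
  assumes f: "subdensity f q" and B: "R i = ereal B" "L i \<le> B" and e: "0 < e" "e \<le> factor i f q"
  shows "\<exists>x\<in>{L i..B}. e / (1 + (B - L i)) \<le> f x"
proof (cases "L i = B")
  case True
  then show ?thesis using e B by (auto simp: factor_def)
next
  case False
  interpret subdensity f q by fact
  define v where "v = e / (1 + (B - L i))"
  have cell: "cell i = {L i<..B}" by (auto simp: cell_def B)
  show ?thesis
  proof (rule ccontr)
    assume "\<not> ?thesis"
    then have less: "f x \<le> v" if "x \<in> {L i..B}" for x using that by (auto simp: v_def not_le less_imp_le)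
    have "e \<le> (LINT x:{L i<..B}|lborel. f x)" using e False B by (simp add: factor_def cell)
    also have "\<dots> \<le> (LINT x:{L i<..B}|lborel. v)"
    proof (rule set_integral_mono)
      show "set_integrable lborel {L i<..B} (\<lambda>x. v)" using B by (simp add: set_integrable_def)
    qed (use less in auto)
    also have "\<dots> = v * (B - L i)" using B by (simp add: set_lebesgue_integral_def)
    also have "\<dots> < v * (1 + (B - L i))" using e B by (intro mult_strict_left_mono) (auto simp: v_def)
    also have "\<dots> = e" using B by (simp add: v_def)
    finally show False by simp
  qed
qed

text \<open>The common outcome of the bounded and the spiking case. It compares likelihoods only,
  because spiking densities have no limit density.\<close>

definition asymptotically_dominated :: "(nat \<Rightarrow> real \<Rightarrow> real) \<Rightarrow> (nat \<Rightarrow> real) \<Rightarrow> bool" where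
  "asymptotically_dominated f p \<longleftrightarrow> (\<exists>r g q b l. strict_mono (r :: nat \<Rightarrow> nat) \<and> subdensity g q \<and> q \<in> Q \<and>
     (\<forall>k. lik (f (r k)) (p (r k)) \<le> b k) \<and> b \<longlonglongrightarrow> l \<and> l \<le> lik g q)"

text \<open>The bounded cell \<open>i1\<close> provides points \<open>m k\<close> in a fixed compact
  interval with values at least \<open>e'\<close>, hence one integrable envelope for all
  \<open>f k\<close>. Non-degeneracy serves to keep mass from escaping entirely to
  \<infinity>.\<close>

lemma bounded_sequence_dominated:
  assumes sub: "\<And>k. subdensity (f k) (p k)" and p: "\<And>k. p k \<in> Q"
    and bound: "\<And>k x. f k x \<le> C" and lik: "\<And>k. c \<le> lik (f k) (p k)" "0 < c"
    and i1: "i1 \<in> {1..n}" "R i1 \<noteq> \<infinity>" and nd: "\<not> degenerate"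
  shows "asymptotically_dominated f p"
proof -
  define D where "D = max C 1"
  have D: "1 \<le> D" "f k x \<le> D" for k x using bound[of k x] by (auto simp: D_def)
  define e where "e = c / D ^ (n - 1)"
  have e: "0 < e" using lik D by (simp add: e_def)
  have e_le: "e \<le> factor i (f k) (p k)" if "i \<in> {1..n}" for i k
  proof -
    have "c \<le> factor i (f k) (p k) * D ^ (n - 1)"
      using lik_le_factor[OF sub[of k] D(1) D(2) that] lik(1)[of k] by linarith
    then show ?thesis using D by (simp add: e_def field_simps)
  qed
  obtain B where B: "R i1 = ereal B" "L i1 \<le> B" using R_cases[OF i1(1)] i1(2) by metis
  define e' where "e' = e / (1 + (B - L i1))"
  have e': "0 < e'" using e B by (simp add: e'_def)
  have "\<exists>x\<in>{L i1..B}. e' \<le> f k x" for k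
    unfolding e'_def using exists_value_in_cell[OF sub B e e_le[OF i1(1)]] .
  then obtain m where m: "\<And>k. m k \<in> {L i1..B}" "\<And>k. e' \<le> f k (m k)" by metis
  define a where "a = e' / exp 1"
  have a: "0 < a" using e' by (simp add: a_def)
  \<comment> \<open>Recentring the exponential tails from \<open>m k\<close> to 0 costs at most the
    factor \<open>exp (a * K)\<close>.\<close>
  define K where "K = max \<bar>L i1\<bar> \<bar>B\<bar>"
  define W where "W x = D * exp 1 * exp (a * K) * exp (- a * \<bar>x - 0\<bar>)" for x :: real
  have dom: "norm (f k x) \<le> W x" for k x
  proof -
    have "f k x \<le> D * exp 1 * exp (- e' * \<bar>x - m k\<bar> / exp 1)"
      using subdensity.tail_bound[OF sub D(2) e' m(2)] .
    also have "\<dots> \<le> D * exp 1 * exp (a * K - a * \<bar>x\<bar>)"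
    proof -
      have "\<bar>m k\<bar> \<le> K" using m(1)[of k] by (auto simp: K_def)
      then have "a * (\<bar>x\<bar> - K) \<le> a * \<bar>x - m k\<bar>" using a by (intro mult_left_mono) auto
      then have "- e' * \<bar>x - m k\<bar> / exp 1 \<le> a * K - a * \<bar>x\<bar>"
        by (simp add: a_def right_diff_distrib)
      then show ?thesis using D(1) by (intro mult_left_mono) auto
    qed
    also have "\<dots> = W x" by (simp add: W_def flip: exp_add)
    finally show ?thesis by (simp add: subdensity.nonneg[OF sub])
  qed
  have W: "integrable lborel W"
    using integral_exp_abs_tail(1)[OF a order_refl, of 0] by (simp add: W_def[abs_def] set_integrable_def)
  have "bounded (range p)"
    by (rule bounded_subset[of "{0..1}"]) (use p Q_bounds(1) less_imp_le[OF Q_bounds(2)] in auto)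
  then obtain q r1 where r1: "strict_mono r1" and q: "(p \<circ> r1) \<longlonglongrightarrow> q"
    using bounded_imp_convergent_subsequence by blast
  obtain r2 g N where r2: "strict_mono r2" and g_nonneg: "\<And>x. 0 \<le> g x" and g: "log_concave g" "usc g"
    and upper: "\<And>x c. g x < c \<Longrightarrow> \<forall>\<^sub>F k in sequentially. f (r1 (r2 k)) x < c"
    and N: "finite N" and lim: "\<And>x. x \<notin> N \<Longrightarrow> (\<lambda>k. f (r1 (r2 k)) x) \<longlonglongrightarrow> g x"
    by (rule log_concave_selection[of "\<lambda>k. f (r1 k)" D])
       (use D subdensity.lc[OF sub] subdensity.nonneg[OF sub] in auto)
  define r where "r = r1 \<circ> r2"
  have r: "strict_mono r" unfolding r_def by (rule strict_mono_o[OF r1 r2])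
  have p_lim: "(\<lambda>k. p (r k)) \<longlonglongrightarrow> q"
    using LIMSEQ_subseq_LIMSEQ[OF q r2] by (simp add: r_def comp_def)
  have AE_lim: "AE x in lborel. x \<notin> N"
    by (rule AE_not_in) (rule finite_imp_null_set_lborel[OF N])
  have g_int: "integrable lborel g"
    by (rule integrable_dominated_convergence[where s = "\<lambda>k. f (r k)" and w = W])
       (use AE_lim W dom usc_borel_measurable[OF g(2)] usc_borel_measurable[OF subdensity.usc[OF sub]] lim in
         \<open>auto simp: r_def\<close>)
  have int_lim: "(\<lambda>k. LINT x:A|lborel. f (r k) x) \<longlonglongrightarrow> (LINT x:A|lborel. g x)" if [measurable]: "A \<in> sets borel" for A
    unfolding set_lebesgue_integral_def
  proof (rule integral_dominated_convergence[where w = W])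
    have [measurable]: "f k \<in> borel_measurable borel" "g \<in> borel_measurable borel" for k
      using usc_borel_measurable[OF g(2)] usc_borel_measurable[OF subdensity.usc[OF sub]] by auto
    show "(\<lambda>x. indicator A x *\<^sub>R g x) \<in> borel_measurable lborel"
      "(\<lambda>x. indicator A x *\<^sub>R f (r k) x) \<in> borel_measurable lborel" for k by measurable
    show "AE x in lborel. (\<lambda>k. indicator A x *\<^sub>R f (r k) x) \<longlonglongrightarrow> indicator A x *\<^sub>R g x"
      using AE_lim by eventually_elim (use lim in \<open>auto simp: r_def intro!: tendsto_intros\<close>)
    show "AE x in lborel. norm (indicator A x *\<^sub>R f (r k) x) \<le> W x" for k
      using dom[of "r k"] order_trans[OF norm_ge_zero dom] by (auto split: split_indicator)
  qed (use W in auto)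
  have q01: "0 \<le> q" "q \<le> 1"
    using p Q_bounds(1) less_imp_le[OF Q_bounds(2)]
    by (auto intro!: LIMSEQ_le_const[OF p_lim] LIMSEQ_le_const2[OF p_lim])
  have small_mass: "\<And>d. 0 < d \<Longrightarrow> \<exists>k. 1 - p (r k) < d" if "q = 1"
    using order_tendstoD(1)[OF p_lim, of "1 - d" for d] that
    by (force simp: algebra_simps eventually_sequentially)
  \<comment> \<open>If the real mass vanished, bounded censored cells would have vanishing factors,
    so all bounded cells would be single points. Non-degeneracy yields two distinct ones; both have
    values at least \<open>e\<close>, and the segment between them keeps a fixed amount of
    mass.\<close>
  have "q \<noteq> 1"
  proof
    assume q1: "q = 1"
    have unc: "ereal (L i) = R i" if i: "i \<in> {1..n}" "R i \<noteq> \<infinity>" for i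
    proof (rule ccontr)
      assume cens: "ereal (L i) \<noteq> R i"
      obtain k where "1 - p (r k) < e" using small_mass[OF q1 e] by blast
      then show False using factor_le_mass[OF sub[of "r k"] cens i(2)] e_le[OF i(1), of "r k"] by linarith
    qed
    have i1_unc: "ereal (L i1) = R i1" using unc i1 by blast
    then have "\<not> covering (L i1)" using nd i1 by (auto simp: degenerate_def)
    moreover have "Q \<noteq> {0}"
    proof
      assume "Q = {0}"
      then have "p (r k) = 0" for k using p by auto
      then show False using p_lim q1 LIMSEQ_unique tendsto_const by fastforce
    qed
    ultimately obtain i where i: "i \<in> {1..n}" "ereal (L i1) \<notin> {ereal (L i)..R i}" "R i \<noteq> \<infinity>"
      unfolding covering_def by blast
    have i_unc: "ereal (L i) = R i" using unc i by blast
    have ne: "0 < \<bar>L i1 - L i\<bar>" using i i_unc by (cases "L i1 = L i") auto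
    obtain k where k: "1 - p (r k) < e * \<bar>L i1 - L i\<bar>" using small_mass[OF q1] e ne by (metis mult_pos_pos)
    have "e \<le> f (r k) (L i1)" "e \<le> f (r k) (L i)"
      using e_le[OF i(1), of "r k"] e_le[OF i1(1), of "r k"] i1_unc i_unc by (auto simp: factor_def)
    from subdensity.segment_mass[OF sub this] k show False by simp
  qed
  then have q_less: "q < 1" using q01 by simp
  have qQ: "q \<in> Q"
  proof (cases "Q = {0}")
    case True
    then have "p (r k) = 0" for k using p by auto
    then show ?thesis using p_lim LIMSEQ_unique[OF p_lim, of 0] True by simp
  qed (use Q q01 q_less in auto)
  have "integral\<^sup>L lborel g = 1 - q"
  proof (rule LIMSEQ_unique)
    show "(\<lambda>k. 1 - p (r k)) \<longlonglongrightarrow> 1 - q" by (intro tendsto_intros p_lim)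
    show "(\<lambda>k. 1 - p (r k)) \<longlonglongrightarrow> integral\<^sup>L lborel g"
      using int_lim[of UNIV] by (simp add: set_lebesgue_integral_def subdensity.mass[OF sub])
  qed
  then have subg: "subdensity g q"
    using g g_nonneg g_int q01 q_less by unfold_locales auto
  \<comment> \<open>At an uncensored point only the upper bound \<open>upper\<close> is available,
    since the point may belong to \<open>N\<close>. The maximum with the limit factor turns this
    into convergence.\<close>
  define b where "b k = (\<Prod>i=1..n. max (factor i (f (r k)) (p (r k))) (factor i g q))" for k
  have "(\<lambda>k. max (factor i (f (r k)) (p (r k))) (factor i g q)) \<longlonglongrightarrow> factor i g q" if i: "i \<in> {1..n}" for i
  proof (cases "ereal (L i) = R i")
    case True
    show ?thesis
    proof (rule order_tendstoI)
      fix c assume "factor i g q < c"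
      then have "\<forall>\<^sub>F k in sequentially. f (r k) (L i) < c" using upper True by (simp add: factor_def r_def)
      then show "\<forall>\<^sub>F k in sequentially. max (factor i (f (r k)) (p (r k))) (factor i g q) < c"
        by eventually_elim (use True \<open>factor i g q < c\<close> in \<open>simp add: factor_def\<close>)
    qed (simp add: less_max_iff_disj)
  next
    case False
    have "(\<lambda>k. factor i (f (r k)) (p (r k))) \<longlonglongrightarrow> factor i g q"
      using False p_lim int_lim[of "cell i"] by (auto simp: factor_def intro!: tendsto_add)
    from tendsto_max[OF this tendsto_const[of "factor i g q"]] show ?thesis by simp
  qed
  then have "b \<longlonglongrightarrow> lik g q" unfolding b_def lik_def by (intro tendsto_prod) auto
  moreover have "lik (f (r k)) (p (r k)) \<le> b k" for k
    unfolding b_def lik_def by (intro prod_mono) (auto simp: factor_nonneg[OF sub])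
  ultimately show ?thesis unfolding asymptotically_dominated_def using r subg qQ by blast
qed

end

section \<open>Spiking sequences\<close>

lemma tendsto_power_mult_exp_neg:
  fixes a :: real
  assumes a: "0 < a"
  shows "((\<lambda>x. x ^ n * exp (- a * x)) \<longlongrightarrow> 0) at_top"
proof -
  have "filterlim (\<lambda>x. a * x) at_top at_top"
    by (rule filterlim_tendsto_pos_mult_at_top[OF tendsto_const a filterlim_ident])
  from filterlim_compose[OF tendsto_power_div_exp_0[of n] this]
  have "((\<lambda>x. (a * x) ^ n / exp (a * x) / a ^ n) \<longlongrightarrow> 0 / a ^ n) at_top"
    using a by (intro tendsto_divide tendsto_const) auto
  then show ?thesis using a by (simp add: power_mult_distrib exp_minus field_simps)
qed

context censored_sample
begin

lemma endpoint_gap: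
  obtains d where "0 < d" "\<And>i. i \<in> {1..n} \<Longrightarrow> L i = \<mu> \<or> d \<le> \<bar>L i - \<mu>\<bar>"
    "\<And>i b. i \<in> {1..n} \<Longrightarrow> R i = ereal b \<Longrightarrow> b = \<mu> \<or> d \<le> \<bar>b - \<mu>\<bar>"
proof -
  \<comment> \<open>An infinite \<open>R i\<close> contributes the default value 0, which is
    harmless in a finite set of points to be avoided.\<close>
  define S where "S = L ` {1..n} \<union> (real_of_ereal \<circ> R) ` {1..n}"
  have "finite S" by (simp add: S_def)
  from finite_set_avoid[OF this, of \<mu>]
  obtain d where d: "0 < d" "\<And>x. x \<in> S \<Longrightarrow> x \<noteq> \<mu> \<Longrightarrow> d \<le> dist \<mu> x" by blast
  have gap: "x = \<mu> \<or> d \<le> \<bar>x - \<mu>\<bar>" if "x \<in> S" for x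
    using d(2)[OF that] by (auto simp: dist_real_def abs_minus_commute)
  show thesis
  proof (rule that[OF d(1)])
    fix i b assume "i \<in> {1..n}" "R i = ereal b"
    then have "b \<in> S" by (auto simp: S_def intro!: image_eqI[of _ _ i])
    then show "b = \<mu> \<or> d \<le> \<bar>b - \<mu>\<bar>" by (rule gap)
  qed (auto simp: S_def intro!: gap)
qed

text \<open>A single observation is controlled by \<open>peak_bound\<close>, a censored one by
  \<open>peak_tail_mass\<close>. The condition on \<open>R i\<close> and \<open>Q\<close> ensures
  that no mass at \<infinity> enters the factor.\<close>

lemma factor_far_from_peak:
  assumes f: "subdensity f p" and p: "p \<in> Q" and i: "i \<in> {1..n}" "R i \<noteq> \<infinity> \<or> Q = {0}"
    and H: "f m = H" "1 \<le> H" and d: "0 < d" "exp 1 < H * d"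
    and far: "m < L i - d \<or> R i + ereal d < ereal m"
  shows "factor i f p \<le> 2 * exp 1 * (H * exp (- (d / exp 1) * H))"
proof (cases "ereal (L i) = R i")
  case True
  interpret subdensity f p by fact
  have dist: "d \<le> \<bar>L i - m\<bar>" using far by (auto simp flip: True)
  then have Hd: "H * d \<le> H * \<bar>L i - m\<bar>" using H by simp
  have "f (L i) \<le> H * exp (- H * \<bar>L i - m\<bar> / exp 1)"
    using peak_bound[of m "L i"] H d Hd by simp
  also have "\<dots> \<le> H * exp (- (d / exp 1) * H)"
    using H Hd by (intro mult_left_mono) (auto simp: divide_right_mono mult.commute)
  also have "\<dots> \<le> 2 * exp 1 * (H * exp (- (d / exp 1) * H))"
  proof -
    have "1 \<le> exp (1::real)" by simp
    then have "1 \<le> 2 * exp (1::real)" by linarith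
    then have "1 * (H * exp (- (d / exp 1) * H)) \<le> 2 * exp 1 * (H * exp (- (d / exp 1) * H))"
      using H by (intro mult_right_mono) auto
    then show ?thesis by simp
  qed
  finally show ?thesis using True by (simp add: factor_def)
next
  case False
  interpret subdensity f p by fact
  have "cell i \<subseteq> {x. d \<le> \<bar>x - m\<bar>}"
    using far i(1) by (cases rule: R_cases[OF i(1)]) (auto simp: cell_def)
  then have "(LINT x:cell i|lborel. f x) \<le> (LINT x:{x. d \<le> \<bar>x - m\<bar>}|lborel. f x)"
    by (rule set_integral_mono_sets) measurable
  also have "\<dots> \<le> 2 * exp 1 * exp (- f m * d / exp 1)"
    using d H by (intro peak_tail_mass) auto
  also have "\<dots> \<le> 2 * exp 1 * (H * exp (- (d / exp 1) * H))"
    using H by (simp add: mult.commute)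
  finally show ?thesis using False i p by (auto simp: factor_def)
qed

text \<open>A cell at distance \<open>d\<close> from the peak has a factor exponentially small in
  the height \<open>H\<close>, while the other factors contribute at most
  \<open>H ^ (n - 1)\<close>. Their product tends to 0, against the lower bound
  \<open>c\<close>.\<close>

lemma cells_touch_peak:
  assumes sub: "\<And>k. subdensity (f k) (p k)" and p: "\<And>k. p k \<in> Q"
    and lik: "\<And>k. c \<le> lik (f k) (p k)" "0 < c"
    and H: "filterlim (\<lambda>k. f k (m k)) at_top sequentially"
    and le_H: "\<And>k i. i \<in> {1..n} \<Longrightarrow> ereal (L i) = R i \<Longrightarrow> f k (L i) \<le> f k (m k)"
    and i: "i \<in> {1..n}" "R i \<noteq> \<infinity> \<or> Q = {0}" and d: "0 < d"
  shows "\<forall>\<^sub>F k in sequentially. L i - d \<le> m k \<and> ereal (m k) \<le> R i + ereal d"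
proof -
  define a where "a = d / exp 1"
  have a: "0 < a" using d by (simp add: a_def)
  have "(\<lambda>k. 2 * exp 1 * (f k (m k) ^ n * exp (- a * f k (m k)))) \<longlonglongrightarrow> 2 * exp 1 * 0"
    by (intro tendsto_mult tendsto_const filterlim_compose[OF tendsto_power_mult_exp_neg[OF a] H])
  then have "\<forall>\<^sub>F k in sequentially. 2 * exp 1 * (f k (m k) ^ n * exp (- a * f k (m k))) < c"
    using lik(2) by (intro order_tendstoD(2)) auto
  moreover have "\<forall>\<^sub>F k in sequentially. max 1 (exp 1 / d + 1) \<le> f k (m k)"
    using H by (simp only: filterlim_at_top)
  ultimately show ?thesis
  proof eventually_elim
    case (elim k)
    let ?H = "f k (m k)"
    have H1: "1 \<le> ?H" and "exp 1 / d < ?H" using elim by auto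
    then have Hd: "exp 1 < ?H * d" using d by (simp add: divide_less_eq)
    show ?case
    proof (rule ccontr)
      assume "\<not> ?thesis"
      then have far: "m k < L i - d \<or> R i + ereal d < ereal (m k)" by auto
      have "lik (f k) (p k) \<le> factor i (f k) (p k) * ?H ^ (n - 1)"
        using lik_le_factor[OF sub H1 le_H i(1)] .
      also have "\<dots> \<le> 2 * exp 1 * (?H * exp (- (d / exp 1) * ?H)) * ?H ^ (n - 1)"
        using H1 by (intro mult_right_mono factor_far_from_peak[OF sub p i refl H1 d Hd far]) auto
      also have "\<dots> = 2 * exp 1 * (?H ^ n * exp (- a * ?H))"
        using n_pos by (cases n) (auto simp: a_def)
      finally show False using elim lik(1)[of k] by linarith
    qed
  qed
qed

text \<open>A spike forces all cells to touch the limit \<open>\<mu>\<close> of the peaks, so without degeneracy there are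
  no uncensored observations.  The likelihood then depends in the limit only on the masses \<open>s\<close> and
  \<open>t\<close> on the two sides of \<open>\<mu>\<close>, and a uniform density on \<open>[\<mu> - \<delta> s, \<mu> + \<delta> t]\<close> realises these masses.\<close>

lemma spiking_sequence_dominated:
  assumes sub: "\<And>k. subdensity (f k) (p k)" and p: "\<And>k. p k \<in> Q"
    and lik: "\<And>k. c \<le> lik (f k) (p k)" "0 < c"
    and H: "filterlim (\<lambda>k. f k (m k)) at_top sequentially"
    and le_H: "\<And>k i. i \<in> {1..n} \<Longrightarrow> ereal (L i) = R i \<Longrightarrow> f k (L i) \<le> f k (m k)"
    and i1: "i1 \<in> {1..n}" "R i1 \<noteq> \<infinity>" and nd: "\<not> degenerate"
  shows "asymptotically_dominated f p"
proof -
  have touch: "\<forall>\<^sub>F k in sequentially. L i - d \<le> m k \<and> ereal (m k) \<le> R i + ereal d"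
    if "i \<in> {1..n}" "R i \<noteq> \<infinity> \<or> Q = {0}" "0 < d" for i d
    by (rule cells_touch_peak[OF sub p lik H]) (use le_H that in auto)
  obtain B where B: "R i1 = ereal B" "L i1 \<le> B" using R_cases[OF i1(1)] i1(2) by metis
  \<comment> \<open>The bounded cell \<open>i1\<close> confines the peaks to a compact set.\<close>
  have "\<forall>\<^sub>F k in sequentially. L i1 - 1 \<le> m k \<and> ereal (m k) \<le> R i1 + ereal 1"
    using touch[OF i1(1) disjI1[OF i1(2)], of 1] by simp
  then have "\<forall>\<^sub>F k in sequentially. norm (m k) \<le> \<bar>L i1\<bar> + \<bar>B\<bar> + 1"
    by eventually_elim (auto simp: B)
  then have "Bseq m"
    by (rule BfunI)
  then obtain Km where Km: "\<And>k. norm (m k) \<le> Km" by (meson BseqE)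
  have p01: "p k \<in> {0..1}" for k using p Q_bounds(1) less_imp_le[OF Q_bounds(2)] by auto
  have "bounded (range (\<lambda>k. (m k, p k)))"
    by (rule bounded_subset[of "cball 0 Km \<times> {0..1}"]) (use Km p01 in \<open>auto intro!: bounded_Times simp: dist_norm\<close>)
  then obtain mp r1 where r1: "strict_mono r1" and mp: "((\<lambda>k. (m k, p k)) \<circ> r1) \<longlonglongrightarrow> mp"
    using bounded_imp_convergent_subsequence by blast
  define \<mu> where "\<mu> = fst mp"
  define q where "q = snd mp"
  have m_lim1: "(\<lambda>k. m (r1 k)) \<longlonglongrightarrow> \<mu>" and p_lim1: "(\<lambda>k. p (r1 k)) \<longlonglongrightarrow> q"
    using tendsto_fst[OF mp] tendsto_snd[OF mp] by (auto simp: comp_def \<mu>_def q_def)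
  define sm where "sm k = (LINT x:{..\<mu>}|lborel. f (r1 k) x)" for k
  define tm where "tm k = (LINT x:{\<mu><..}|lborel. f (r1 k) x)" for k
  have st: "sm k + tm k = 1 - p (r1 k)" "0 \<le> sm k" "0 \<le> tm k" for k
  proof -
    have "sm k + tm k = (LINT x:({..\<mu>} \<union> {\<mu><..})|lborel. f (r1 k) x)"
      unfolding sm_def tm_def by (intro set_integral_Un[symmetric]) (auto simp: subdensity.set_integrable[OF sub])
    also have "{..\<mu>} \<union> {\<mu><..} = UNIV" by auto
    finally show "sm k + tm k = 1 - p (r1 k)"
      by (simp add: set_lebesgue_integral_def subdensity.mass[OF sub])
  qed (auto simp: sm_def tm_def subdensity.set_integral_nonneg[OF sub])
  have "bounded (range sm)"
  proof (rule bounded_subset[of "{0..1}"])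
    show "range sm \<subseteq> {0..1}"
    proof
      fix y assume "y \<in> range sm"
      then obtain k where "y = sm k" by blast
      then show "y \<in> {0..1}" using st[of k] p01[of "r1 k"] by auto
    qed
  qed simp
  then obtain s r2 where r2: "strict_mono r2" and s: "(sm \<circ> r2) \<longlonglongrightarrow> s"
    using bounded_imp_convergent_subsequence by blast
  define r where "r = r1 \<circ> r2"
  have r: "strict_mono r" unfolding r_def by (rule strict_mono_o[OF r1 r2])
  have m_lim: "(\<lambda>k. m (r k)) \<longlonglongrightarrow> \<mu>" and p_lim: "(\<lambda>k. p (r k)) \<longlonglongrightarrow> q"
    using LIMSEQ_subseq_LIMSEQ[OF m_lim1 r2] LIMSEQ_subseq_LIMSEQ[OF p_lim1 r2] by (auto simp: r_def comp_def)
  have s_lim: "(\<lambda>k. sm (r2 k)) \<longlonglongrightarrow> s" using s by (simp add: comp_def)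
  define t where "t = 1 - q - s"
  have t_lim: "(\<lambda>k. tm (r2 k)) \<longlonglongrightarrow> t"
  proof -
    have "(\<lambda>k. 1 - p (r k) - sm (r2 k)) \<longlonglongrightarrow> t" unfolding t_def by (intro tendsto_intros p_lim s_lim)
    moreover have "1 - p (r k) - sm (r2 k) = tm (r2 k)" for k using st(1)[of "r2 k"] by (simp add: r_def)
    ultimately show ?thesis by simp
  qed
  have s0: "0 \<le> s" using st by (intro LIMSEQ_le_const[OF s_lim]) auto
  have t0: "0 \<le> t" using st by (intro LIMSEQ_le_const[OF t_lim]) auto
  have q0: "0 \<le> q" using p01 by (intro LIMSEQ_le_const[OF p_lim]) auto
  have cover: "L i \<le> \<mu> \<and> ereal \<mu> \<le> R i" if i: "i \<in> {1..n}" "R i \<noteq> \<infinity> \<or> Q = {0}" for i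
  proof
    have ev: "\<forall>\<^sub>F k in sequentially. L i - d \<le> m (r k) \<and> ereal (m (r k)) \<le> R i + ereal d" if "0 < d" for d
      using touch[OF i that] eventually_subseq[OF r] by blast
    show "L i \<le> \<mu>"
    proof (rule field_le_epsilon)
      fix d :: real assume "0 < d"
      from ev[OF this] have "L i - d \<le> \<mu>"
        by (intro tendsto_lowerbound[OF m_lim]) (auto elim: eventually_mono)
      then show "L i \<le> \<mu> + d" by simp
    qed
    show "ereal \<mu> \<le> R i"
    proof (cases rule: R_cases[OF i(1)])
      case (2 b)
      have "\<mu> \<le> b"
      proof (rule field_le_epsilon)
        fix d :: real assume "0 < d"
        from ev[OF this] show "\<mu> \<le> b + d"
          by (intro tendsto_upperbound[OF m_lim]) (auto elim: eventually_mono simp: 2)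
      qed
      then show ?thesis by (simp add: 2)
    qed simp
  qed
  have cens: "ereal (L j) \<noteq> R j" if j: "j \<in> {1..n}" for j
  proof
    assume eq: "ereal (L j) = R j"
    then have "R j \<noteq> \<infinity>" by auto
    then have "L j = \<mu>" using cover[OF j] by (auto simp flip: eq)
    then have "covering (L j)" using cover by (auto simp: covering_def)
    then show False using nd j eq by (auto simp: degenerate_def)
  qed
  obtain \<eta> where \<eta>: "0 < \<eta>" "\<And>i. i \<in> {1..n} \<Longrightarrow> L i = \<mu> \<or> \<eta> \<le> \<bar>L i - \<mu>\<bar>"
    "\<And>i b. i \<in> {1..n} \<Longrightarrow> R i = ereal b \<Longrightarrow> b = \<mu> \<or> \<eta> \<le> \<bar>b - \<mu>\<bar>"
    using endpoint_gap[of \<mu>] by metis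
  \<comment> \<open>The mass not near \<mu>. Once \<open>m (r k)\<close> is within
    \<open>\<eta> / 2\<close> of \<mu>, the peak tail bound at distance \<open>\<eta> / 2\<close>
    forces it to 0.\<close>
  define out where "out k = (LINT x:{x. \<eta> \<le> \<bar>x - \<mu>\<bar>}|lborel. f (r k) x)" for k
  have Hr: "filterlim (\<lambda>k. f (r k) (m (r k))) at_top sequentially"
    by (rule filterlim_compose[OF H filterlim_subseq[OF r]])
  have out_lim: "out \<longlonglongrightarrow> 0"
  proof (rule tendsto_sandwich[OF _ _ tendsto_const])
    show "\<forall>\<^sub>F k in sequentially. 0 \<le> out k" by (simp add: out_def subdensity.set_integral_nonneg[OF sub])
    define a where "a = \<eta> / 2 / exp 1"
    have a: "0 < a" using \<eta> by (simp add: a_def)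
    have "(\<lambda>k. 2 * exp 1 * (f (r k) (m (r k)) ^ 0 * exp (- a * f (r k) (m (r k))))) \<longlonglongrightarrow> 2 * exp 1 * 0"
      by (intro tendsto_mult tendsto_const filterlim_compose[OF tendsto_power_mult_exp_neg[OF a] Hr])
    then show "(\<lambda>k. 2 * exp 1 * exp (- a * f (r k) (m (r k)))) \<longlonglongrightarrow> 0" by simp
    have "\<forall>\<^sub>F k in sequentially. dist (m (r k)) \<mu> < \<eta> / 2" using m_lim \<eta>(1) by (intro tendstoD) auto
    moreover have "\<forall>\<^sub>F k in sequentially. exp 1 / (\<eta> / 2) + 1 \<le> f (r k) (m (r k))"
      using Hr by (simp only: filterlim_at_top)
    ultimately show "\<forall>\<^sub>F k in sequentially. out k \<le> 2 * exp 1 * exp (- a * f (r k) (m (r k)))"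
    proof eventually_elim
      case (elim k)
      then have "exp 1 / (\<eta> / 2) < f (r k) (m (r k))" by simp
      then have far: "exp 1 < f (r k) (m (r k)) * (\<eta> / 2)" using \<eta>(1) by (subst (asm) divide_less_eq) simp
      have "out k \<le> (LINT x:{x. \<eta> / 2 \<le> \<bar>x - m (r k)\<bar>}|lborel. f (r k) x)"
        unfolding out_def
      proof (rule subdensity.set_integral_mono_sets[OF sub])
        show "{x. \<eta> \<le> \<bar>x - \<mu>\<bar>} \<subseteq> {x. \<eta> / 2 \<le> \<bar>x - m (r k)\<bar>}"
          using elim(1) unfolding dist_real_def by (intro subsetI, unfold mem_Collect_eq) linarith
      qed auto
      also have "\<dots> \<le> 2 * exp 1 * exp (- f (r k) (m (r k)) * (\<eta> / 2) / exp 1)"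
        using far \<eta>(1) by (intro subdensity.peak_tail_mass[OF sub]) auto
      finally show ?case by (simp add: a_def mult.commute)
    qed
  qed
  \<comment> \<open>By the choice of \<eta>, within this distance a cell contains either everything
    or nothing on each side of \<mu>. The three coefficients record whether it receives the left
    mass, the right mass and the mass at \<infinity>.\<close>
  define \<alpha> where "\<alpha> i = (of_bool (L i < \<mu> \<and> ereal \<mu> \<le> R i) :: real)" for i
  define \<beta> where "\<beta> i = (of_bool (L i \<le> \<mu> \<and> ereal \<mu> < R i) :: real)" for i
  define \<gamma> where "\<gamma> i = (of_bool (R i = \<infinity>) :: real)" for i
  define a where "a i k = \<alpha> i * sm (r2 k) + \<beta> i * tm (r2 k) + \<gamma> i * p (r k) + out k" for i k
  define a' where "a' i = \<alpha> i * s + \<beta> i * t + \<gamma> i * q" for i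
  have a_lim: "a i \<longlonglongrightarrow> a' i" for i
  proof -
    have "(\<lambda>k. a i k) \<longlonglongrightarrow> \<alpha> i * s + \<beta> i * t + \<gamma> i * q + 0"
      unfolding a_def by (intro tendsto_intros s_lim t_lim p_lim out_lim)
    then show ?thesis by (simp add: a'_def)
  qed
  have factor_le_a: "factor i (f (r k)) (p (r k)) \<le> a i k" if i: "i \<in> {1..n}" for i k
  proof -
    interpret subdensity "f (r k)" "p (r k)" by (rule sub)
    have I: "integrable lborel (\<lambda>x. indicator A x *\<^sub>R f (r k) x)" if "A \<in> sets borel" for A
      using set_integrable[OF that] unfolding set_integrable_def .
    have "(LINT x:cell i|lborel. f (r k) x) \<le>
      (LINT x|lborel. \<alpha> i * (indicator {..\<mu>} x *\<^sub>R f (r k) x) + \<beta> i * (indicator {\<mu><..} x *\<^sub>R f (r k) x)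
          + indicator {x. \<eta> \<le> \<bar>x - \<mu>\<bar>} x *\<^sub>R f (r k) x)"
      unfolding set_lebesgue_integral_def
    proof (rule integral_mono)
      fix x
      show "indicator (cell i) x *\<^sub>R f (r k) x \<le> \<alpha> i * (indicator {..\<mu>} x *\<^sub>R f (r k) x) +
          \<beta> i * (indicator {\<mu><..} x *\<^sub>R f (r k) x) + indicator {x. \<eta> \<le> \<bar>x - \<mu>\<bar>} x *\<^sub>R f (r k) x"
      proof (cases "x \<in> cell i \<and> \<bar>x - \<mu>\<bar> < \<eta>")
        case True
        then have x: "L i < x" "ereal x \<le> R i" "\<bar>x - \<mu>\<bar> < \<eta>" by (auto simp: cell_def)
        show ?thesis
        proof (cases "x \<le> \<mu>")
          case le: True
          have "ereal \<mu> \<le> R i"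
            using R_cases[OF i] \<eta>(3)[OF i] x le by (cases rule: R_cases[OF i]) force+
          then show ?thesis using True le x by (simp add: \<alpha>_def)
        next
          case False
          have "L i \<le> \<mu>" using \<eta>(2)[OF i] x False by auto
          moreover have "ereal \<mu> < R i" using x False by (cases "R i") auto
          ultimately show ?thesis using True False x by (simp add: \<beta>_def)
        qed
      next
        case False
        then show ?thesis using nonneg by (auto simp: \<alpha>_def \<beta>_def split: split_indicator)
      qed
    qed (intro Bochner_Integration.integrable_add integrable_mult_right I; simp)+
    also have "\<dots> = \<alpha> i * sm (r2 k) + \<beta> i * tm (r2 k) + out k"
      unfolding sm_def tm_def out_def set_lebesgue_integral_def r_def comp_def
      using I by (simp add: r_def)
    finally show ?thesis using cens[OF i] by (auto simp: factor_def a_def \<gamma>_def)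
  qed
  define b where "b k = (\<Prod>i=1..n. a i k)" for k
  have lik_le: "lik (f (r k)) (p (r k)) \<le> b k" for k
    unfolding b_def lik_def by (intro prod_mono conjI factor_nonneg[OF sub] factor_le_a)
  have b_lim: "b \<longlonglongrightarrow> (\<Prod>i=1..n. a' i)" unfolding b_def by (intro tendsto_prod a_lim)
  have "c \<le> (\<Prod>i=1..n. a' i)"
    using lik_le lik(1) by (intro LIMSEQ_le_const[OF b_lim]) (meson order_trans)
  with lik(2) have prod_pos: "0 < (\<Prod>i=1..n. a' i)" by linarith
  \<comment> \<open>A bounded cell gets nothing from \<infinity>, so its positive limit factor needs
    mass beside \<mu>; this yields \<open>q < 1\<close>.\<close>
  have "a' i1 \<noteq> 0"
  proof
    assume "a' i1 = 0"
    then have "(\<Prod>i=1..n. a' i) = 0" using i1(1) by (intro prod_zero) auto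
    then show False using prod_pos by (metis less_irrefl)
  qed
  then have "s \<noteq> 0 \<or> t \<noteq> 0" using i1(2) by (auto simp: a'_def \<gamma>_def)
  then have st_pos: "0 < s + t" using s0 t0 by linarith
  then have q1: "q < 1" by (simp add: t_def)
  have qQ: "q \<in> Q"
  proof (cases "Q = {0}")
    case True
    then have "p (r k) = 0" for k using p by auto
    then show ?thesis using p_lim LIMSEQ_unique[OF p_lim, of 0] True by simp
  qed (use Q q0 q1 in auto)
  \<comment> \<open>The length \<open>\<eta> * (1 - q)\<close> gives height
    \<open>1 / \<eta>\<close>, hence masses exactly \<open>s\<close> and \<open>t\<close> on the two
    sides. As both are at most 1, the interval stays within the gap \<eta>.\<close>
  define x0 where "x0 = \<mu> - \<eta> * s"
  define x1 where "x1 = \<mu> + \<eta> * t"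
  define g where "g x = indicator {x0..x1} x * ((1 - q) / (x1 - x0))" for x
  have x01: "x0 < x1" "(1 - q) / (x1 - x0) = 1 / \<eta>"
  proof -
    have "x1 - x0 = \<eta> * (s + t)" by (simp add: x0_def x1_def algebra_simps)
    moreover have "s + t = 1 - q" by (simp add: t_def)
    moreover have "0 < \<eta> * (s + t)" using \<eta>(1) st_pos by simp
    ultimately show "x0 < x1" "(1 - q) / (x1 - x0) = 1 / \<eta>" using st_pos by auto
  qed
  have subg: "subdensity g q" unfolding g_def[abs_def] by (rule subdensity_uniform[OF x01(1) q0 q1])
  have s1: "\<eta> * s \<le> \<eta>" "\<eta> * t \<le> \<eta>" using s0 t0 q0 \<eta>(1) by (auto simp: t_def mult_left_le)
  have nn: "0 \<le> \<eta> * s" "0 \<le> \<eta> * t" using s0 t0 \<eta>(1) by auto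
  have le_factor: "a' i \<le> factor i g q" if i: "i \<in> {1..n}" for i
  proof -
    have mass: "(d - c) / \<eta> \<le> (LINT x:cell i|lborel. g x)"
      if "c \<le> d" "x0 \<le> c" "d \<le> x1" "{c<..d} \<subseteq> cell i" for c d
      using uniform_mass_ge[OF x01(1) q0 q1 that(1-3) cell_borel that(4)] x01(2) by (simp add: g_def)
    have left: "L i \<le> x0" if "\<alpha> i \<noteq> 0"
      using that \<eta>(2)[OF i] s1 by (auto simp: \<alpha>_def x0_def)
    have right: "ereal x1 \<le> R i" if "\<beta> i \<noteq> 0"
    proof (cases rule: R_cases[OF i])
      case (2 b)
      then have "\<mu> < b" using that by (auto simp: \<beta>_def)
      then show ?thesis using \<eta>(3)[OF i 2(1)] s1 by (auto simp: 2 x1_def)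
    qed simp
    have "\<alpha> i = 0 \<or> \<alpha> i = 1" "\<beta> i = 0 \<or> \<beta> i = 1"
      unfolding \<alpha>_def \<beta>_def of_bool_def by (simp_all split: if_split)
    then consider "\<alpha> i = 0" "\<beta> i = 0" | "\<alpha> i = 1" "\<beta> i = 0" | "\<alpha> i = 0" "\<beta> i = 1" | "\<alpha> i = 1" "\<beta> i = 1"
      by blast
    then have "\<alpha> i * s + \<beta> i * t \<le> (LINT x:cell i|lborel. g x)"
    proof cases
      case 1
      then show ?thesis by (simp add: subdensity.set_integral_nonneg[OF subg])
    next
      case 2
      then have *: "L i \<le> x0" "ereal \<mu> \<le> R i" using left by (auto simp: \<alpha>_def)
      have "(\<mu> - x0) / \<eta> \<le> (LINT x:cell i|lborel. g x)"
        using * nn by (intro mass) (auto simp: cell_def x0_def x1_def intro: order_trans[of _ "ereal \<mu>"])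
      then show ?thesis using 2 \<eta>(1) by (simp add: x0_def)
    next
      case 3
      then have *: "L i \<le> \<mu>" "ereal x1 \<le> R i" using right by (auto simp: \<beta>_def)
      have "(x1 - \<mu>) / \<eta> \<le> (LINT x:cell i|lborel. g x)"
        using * nn by (intro mass) (auto simp: cell_def x0_def x1_def intro: order_trans[of _ "ereal (\<mu> + \<eta> * t)"])
      then show ?thesis using 3 \<eta>(1) by (simp add: x1_def)
    next
      case 4
      then have *: "L i \<le> x0" "ereal x1 \<le> R i" using left right by auto
      have "(x1 - x0) / \<eta> \<le> (LINT x:cell i|lborel. g x)"
        using * x01 by (intro mass) (auto simp: cell_def intro: order_trans[of _ "ereal x1"])
      then show ?thesis using 4 \<eta>(1) by (simp add: x0_def x1_def add_divide_distrib)
    qed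
    then show ?thesis using cens[OF i] by (auto simp: factor_def a'_def \<gamma>_def)
  qed
  have "(\<Prod>i=1..n. a' i) \<le> lik g q"
    unfolding lik_def
    by (intro prod_mono conjI le_factor) (auto simp: a'_def \<alpha>_def \<beta>_def \<gamma>_def s0 t0 q0)
  then show ?thesis unfolding asymptotically_dominated_def using r subg qQ lik_le b_lim by blast
qed

end

section \<open>Existence of maximizers\<close>

context censored_sample
begin

text \<open>The thresholds \<open>v\<close> are used twice: unbounded ones refute an infinite
  supremum, and ones converging to the supremum produce a maximizer.\<close>

lemma maximizing_sequence:
  assumes sub: "\<And>k. subdensity (f k) (p k)" and p: "\<And>k. p k \<in> Q"
    and v: "\<And>k. v k \<le> lik (f k) (p k)" "incseq v" "0 < v 0"
    and i1: "i1 \<in> {1..n}" "R i1 \<noteq> \<infinity>" and nd: "\<not> degenerate"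
  shows "\<exists>g q. subdensity g q \<and> q \<in> Q \<and> (\<forall>k. v k \<le> lik g q)"
proof -
  have v0: "v 0 \<le> lik (f k) (p k)" for k
    using v(1)[of k] incseqD[OF v(2), of 0 k] by simp
  \<comment> \<open>The selection only satisfies \<open>j \<le> \<kappa> j\<close>; this is enough,
    because \<open>v\<close> is increasing.\<close>
  obtain \<kappa> where \<kappa>: "\<And>j. j \<le> \<kappa> j" and dom: "asymptotically_dominated (\<lambda>j. f (\<kappa> j)) (\<lambda>j. p (\<kappa> j))"
  proof (cases "\<exists>C. \<forall>j. \<exists>k\<ge>j. \<forall>x. f k x \<le> C")
    case True
    then obtain C where "\<forall>j. \<exists>k\<ge>j. \<forall>x. f k x \<le> C" by blast
    then obtain \<kappa> where \<kappa>: "\<And>j. j \<le> \<kappa> j" "\<And>j x. f (\<kappa> j) x \<le> C" by metis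
    show thesis
      by (rule that[OF \<kappa>(1) bounded_sequence_dominated[OF sub p \<kappa>(2) v0 v(3) i1 nd]])
  next
    case False
    have "\<exists>k\<ge>j. \<exists>x. real j < f k x" for j
    proof -
      from False have "\<not> (\<forall>j'. \<exists>k\<ge>j'. \<forall>x. f k x \<le> real j)" by blast
      then obtain j' where "\<And>k. j' \<le> k \<Longrightarrow> \<exists>x. real j < f k x" by (meson not_le)
      then show ?thesis by (intro exI[of _ "max j j'"]) auto
    qed
    then obtain \<kappa> y where \<kappa>: "\<And>j. j \<le> \<kappa> j" and y: "\<And>j. real j < f (\<kappa> j) (y j)" by metis
    \<comment> \<open>A largest value among finitely many points serves as the peak: it inherits
      divergence from \<open>y j\<close> and dominates all values at uncensored
      observations.\<close>
    have "\<exists>m. f (\<kappa> j) (y j) \<le> f (\<kappa> j) m \<and> (\<forall>i\<in>{1..n}. f (\<kappa> j) (L i) \<le> f (\<kappa> j) m)" for j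
    proof -
      let ?S = "f (\<kappa> j) ` insert (y j) (L ` {1..n})"
      have "Max ?S \<in> ?S" by (intro Max_in) auto
      then obtain m where "Max ?S = f (\<kappa> j) m" by blast
      moreover have "z \<le> Max ?S" if "z \<in> ?S" for z using that by (intro Max_ge) auto
      ultimately show ?thesis by auto
    qed
    then obtain m where m: "\<And>j. f (\<kappa> j) (y j) \<le> f (\<kappa> j) (m j)"
      "\<And>j i. i \<in> {1..n} \<Longrightarrow> f (\<kappa> j) (L i) \<le> f (\<kappa> j) (m j)" by metis
    have "filterlim (\<lambda>j. f (\<kappa> j) (m j)) at_top sequentially"
      by (rule filterlim_at_top_mono[OF filterlim_real_sequentially])
         (use less_imp_le[OF less_le_trans[OF y m(1)]] in auto)
    then show thesis
      by (intro that[OF \<kappa>] spiking_sequence_dominated[OF sub p v0 v(3) _ _ i1 nd]) (use m(2) in auto)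
  qed
  then obtain r g q b l where r: "strict_mono (r :: nat \<Rightarrow> nat)" and g: "subdensity g q" "q \<in> Q"
    and b: "\<And>k. lik (f (\<kappa> (r k))) (p (\<kappa> (r k))) \<le> b k" "b \<longlonglongrightarrow> l" "l \<le> lik g q"
    unfolding asymptotically_dominated_def by blast
  have "v k \<le> lik g q" for k
  proof -
    have "v k \<le> b j" if "k \<le> j" for j
    proof -
      have "k \<le> \<kappa> (r j)" using that seq_suble[OF r, of j] \<kappa>[of "r j"] by linarith
      then have "v k \<le> v (\<kappa> (r j))" by (rule incseqD[OF v(2)])
      also have "\<dots> \<le> lik (f (\<kappa> (r j))) (p (\<kappa> (r j)))" by (rule v(1))
      also have "\<dots> \<le> b j" by (rule b(1))
      finally show ?thesis .
    qed
    then have "v k \<le> l" by (intro LIMSEQ_le_const[OF b(2)]) blast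
    then show ?thesis using b(3) by linarith
  qed
  then show ?thesis using g by blast
qed

lemma lik_nonneg: "subdensity f q \<Longrightarrow> 0 \<le> lik f q"
  unfolding lik_def by (intro prod_nonneg ballI factor_nonneg)

text \<open>A uniform density on an interval wide enough to contain all finite end points strictly
  inside gives each factor a positive value.\<close>

lemma exists_positive_lik: "\<exists>f. subdensity f 0 \<and> 0 < lik f 0"
proof -
  define K where "K = 1 + (\<Sum>i=1..n. \<bar>L i\<bar> + \<bar>real_of_ereal (R i)\<bar>)"
  have K: "\<bar>L i\<bar> + \<bar>real_of_ereal (R i)\<bar> < K" if "i \<in> {1..n}" for i
  proof -
    have "\<bar>L i\<bar> + \<bar>real_of_ereal (R i)\<bar> \<le> (\<Sum>i=1..n. \<bar>L i\<bar> + \<bar>real_of_ereal (R i)\<bar>)"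
      by (rule member_le_sum[OF that _ finite_atLeastAtMost]) (intro add_nonneg_nonneg abs_ge_zero)
    then show ?thesis unfolding K_def by linarith
  qed
  have K0: "- K < K"
    using K[of 1] n_pos abs_ge_zero[of "L 1"] abs_ge_zero[of "real_of_ereal (R 1)"]
    unfolding atLeastAtMost_iff by linarith
  define f where "f x = indicator {-K..K} x * ((1 - 0) / (K - (- K)))" for x
  have f: "subdensity f 0" unfolding f_def[abs_def] by (rule subdensity_uniform[OF K0]) auto
  have L_in: "L i \<in> {-K..K}" if "i \<in> {1..n}" for i
    using K[OF that] abs_ge_zero[of "real_of_ereal (R i)"] unfolding atLeastAtMost_iff by linarith
  have "0 < factor i f 0" if i: "i \<in> {1..n}" for i
  proof (cases "ereal (L i) = R i")
    case True
    then show ?thesis using K0 L_in[OF i] by (simp add: factor_def f_def)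
  next
    case False
    define d where "d = (if R i = \<infinity> then K else real_of_ereal (R i))"
    have d: "L i < d" "d \<le> K" "ereal d \<le> R i"
      using False K[OF i] by (cases rule: R_cases[OF i]; auto simp: d_def)+
    have "(d - L i) * ((1 - 0) / (K - (- K))) \<le> (LINT x:cell i|lborel. f x)"
      unfolding f_def
      by (rule uniform_mass_ge)
         (use K0 d L_in[OF i] in \<open>auto simp: cell_def intro: order_trans[of _ "ereal d"]\<close>)
    moreover have "0 < (d - L i) * ((1 - 0) / (K - (- K)))" using d K0 by simp
    ultimately show ?thesis using False by (simp add: factor_def)
  qed
  then show ?thesis using f unfolding lik_def by (intro exI[of _ f]) (auto intro!: prod_pos)
qed

lemma maximizer_exists:
  assumes nd: "\<not> degenerate"
  shows "\<exists>g q. subdensity g q \<and> q \<in> Q \<and> (\<forall>f p. subdensity f p \<longrightarrow> p \<in> Q \<longrightarrow> lik f p \<le> lik g q)"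
proof (cases "\<forall>i\<in>{1..n}. R i = \<infinity>")
  case True
  define M where "M = Max (L ` {1..n})"
  have M: "L i \<le> M" if "i \<in> {1..n}" for i using that by (simp add: M_def)
  define g where "g x = indicator {M..M + 1} x * ((1 - 0) / (M + 1 - M))" for x
  have g: "subdensity g 0" unfolding g_def[abs_def] by (rule subdensity_uniform) auto
  have "1 \<le> factor i g 0" if i: "i \<in> {1..n}" for i
  proof -
    have "(M + 1 - M) * ((1 - 0) / (M + 1 - M)) \<le> (LINT x:cell i|lborel. g x)"
      unfolding g_def by (rule uniform_mass_ge) (use M[OF i] True i in \<open>auto simp: cell_def\<close>)
    then show ?thesis using True i by (simp add: factor_def)
  qed
  then have "(\<Prod>i=1..n. 1) \<le> lik g 0" unfolding lik_def by (intro prod_mono) auto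
  moreover have "lik f p \<le> (\<Prod>i=1..n. 1)" if f: "subdensity f p" for f p
    unfolding lik_def
  proof (intro prod_mono conjI factor_nonneg factor_le f)
    fix i assume "i \<in> {1..n}" "ereal (L i) = R i"
    then show "f (L i) \<le> 1" using True by auto
  qed simp
  ultimately show ?thesis using g Q_bounds(3) order_trans by blast
next
  case False
  then obtain i1 where i1: "i1 \<in> {1..n}" "R i1 \<noteq> \<infinity>" by blast
  define A where "A = {lik f p | f p. subdensity f p \<and> p \<in> Q}"
  have seq: "\<exists>g q. subdensity g q \<and> q \<in> Q \<and> (\<forall>k. v k \<le> lik g q)"
    if v: "\<And>k. \<exists>y\<in>A. v k < y" "incseq v" "0 < v 0" for v :: "nat \<Rightarrow> real"
  proof -
    have "\<exists>f p. subdensity f p \<and> p \<in> Q \<and> v k \<le> lik f p" for k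
      using v(1)[of k] by (auto simp: A_def intro: less_imp_le)
    then obtain f p where "\<And>k. subdensity (f k) (p k)" "\<And>k. p k \<in> Q" "\<And>k. v k \<le> lik (f k) (p k)" by metis
    from maximizing_sequence[OF this v(2,3) i1 nd] show ?thesis .
  qed
  obtain f0 where f0: "subdensity f0 0" "0 < lik f0 0" using exists_positive_lik by blast
  then have f0A: "lik f0 0 \<in> A" using Q_bounds(3) by (auto simp: A_def)
  have "bdd_above A"
  proof (rule ccontr)
    assume "\<not> bdd_above A"
    then have "\<exists>y\<in>A. real k + 1 < y" for k by (auto simp: bdd_above_def not_le)
    from seq[of "\<lambda>k. real k + 1", OF this] obtain g q where "\<forall>k. real k + 1 \<le> lik g q"
      by (auto simp: incseq_def)
    moreover obtain k where "lik g q < real k" using reals_Archimedean2 by blast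
    ultimately show False by (smt (verit))
  qed
  define S where "S = Sup A"
  have S: "y \<le> S" if "y \<in> A" for y unfolding S_def by (rule cSup_upper[OF that \<open>bdd_above A\<close>])
  have S0: "0 < S" using S[OF f0A] f0 by linarith
  \<comment> \<open>Increases to \<open>S\<close> strictly from below and starts at
    \<open>S / 2\<close>, so every threshold is positive.\<close>
  define v where "v k = S - S / 2 * inverse (real (Suc k))" for k
  have vS: "v k < S" for k using S0 by (simp add: v_def)
  have "\<exists>y\<in>A. v k < y" for k
    using less_cSupD[of A "v k"] f0A vS[of k] by (auto simp: S_def)
  moreover have "incseq v"
    unfolding v_def using S0 by (intro incseq_SucI diff_mono mult_left_mono) (auto simp: field_simps)
  moreover have "0 < v 0" using S0 by (simp add: v_def)
  ultimately obtain g q where g: "subdensity g q" "q \<in> Q" "\<And>k. v k \<le> lik g q" using seq by blast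
  have "v \<longlonglongrightarrow> S - S / 2 * 0"
    unfolding v_def by (intro tendsto_intros LIMSEQ_inverse_real_of_nat)
  then have "S \<le> lik g q" using g(3) by (intro LIMSEQ_le_const2[of v]) auto
  then show ?thesis using g(1,2) S by (intro exI[of _ g] exI[of _ q]) (auto simp: A_def intro: order_trans)
qed

text \<open>Uniform densities of half-width \<open>h\<close> around the uncensored point make its
  factor at least \<open>1 / (4 * h)\<close>, while all other factors stay above
  \<open>1 / 4\<close>.\<close>

lemma degenerate_unbounded:
  assumes degenerate
  shows "\<exists>f p. subdensity f p \<and> p \<in> Q \<and> B < lik f p"
proof -
  obtain j where j: "j \<in> {1..n}" "ereal (L j) = R j" "covering (L j)"
    using assms by (auto simp: degenerate_def)
  define x where "x = L j"
  \<comment> \<open>In part (b) half of the mass is placed at \<infinity>, for the cells that reach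
    \<infinity> but miss \<open>x\<close>.\<close>
  define q :: real where "q = (if Q = {0} then 0 else 1 / 2)"
  have q: "0 \<le> q" "q < 1" "1 / 2 \<le> 1 - q" "q \<in> Q" using Q by (auto simp: q_def)
  obtain \<eta> where \<eta>: "0 < \<eta>" "\<And>i. i \<in> {1..n} \<Longrightarrow> L i = x \<or> \<eta> \<le> \<bar>L i - x\<bar>"
    "\<And>i b. i \<in> {1..n} \<Longrightarrow> R i = ereal b \<Longrightarrow> b = x \<or> \<eta> \<le> \<bar>b - x\<bar>"
    using endpoint_gap[of x] by metis
  define c where "c = (1 / 4 :: real) ^ (n - 1)"
  define h where "h = min (min \<eta> 1) (c / (4 * (\<bar>B\<bar> + 1)))"
  have h: "0 < h" "h \<le> \<eta>" "h \<le> 1" "h \<le> c / (4 * (\<bar>B\<bar> + 1))" using \<eta> by (auto simp: h_def c_def)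
  define f where "f y = indicator {x - h..x + h} y * ((1 - q) / ((x + h) - (x - h)))" for y
  have f: "subdensity f q" unfolding f_def[abs_def] using h q by (intro subdensity_uniform) auto
  have fx: "1 / (4 * h) \<le> f x" using h q by (simp add: f_def field_simps)
  have ge: "1 / 4 \<le> factor i f q" if i: "i \<in> {1..n}" for i
  proof (cases "ereal (L i) = R i")
    case True
    then have "R i \<noteq> \<infinity>" by auto
    then have "ereal (L j) \<in> {ereal (L i)..R i}" using j(3) i unfolding covering_def by blast
    then have "L i = x" by (simp add: x_def flip: True)
    moreover have "1 / 4 \<le> 1 / (4 * h)" using h by (simp add: field_simps)
    ultimately show ?thesis using True fx by (simp add: factor_def)
  next
    case False
    \<comment> \<open>A censored cell touching \<open>x\<close> contains the left half
      \<open>{x - h<..x}\<close> or the right half \<open>{x<..x + h}\<close> of the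
      support.\<close>
    have mass: "h * ((1 - q) / ((x + h) - (x - h))) \<le> (LINT y:cell i|lborel. f y)"
      if "d = x \<or> d = x + h" "{d - h<..d} \<subseteq> cell i" for d
      using uniform_mass_ge[of "x - h" "x + h" q "d - h" d "cell i"] that h q by (auto simp: f_def)
    have half: "1 / 4 \<le> h * ((1 - q) / ((x + h) - (x - h)))" using h q by (simp add: field_simps)
    have nn: "0 \<le> (LINT y:cell i|lborel. f y)" by (rule subdensity.set_integral_nonneg[OF f])
    show ?thesis
    proof (cases "ereal x \<in> {ereal (L i)..R i}")
      case in_cell: True
      have "1 / 4 \<le> (LINT y:cell i|lborel. f y)"
      proof (cases "ereal x = R i")
        case True
        have "L i \<le> x" using in_cell by simp
        moreover have "L i \<noteq> x" using True False by auto
        ultimately have "L i < x" by simp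
        then have "{x - h<..x} \<subseteq> cell i" using \<eta>(2)[OF i] h by (auto simp: cell_def simp flip: True)
        then show ?thesis using mass[of x] half by linarith
      next
        case False
        then have "ereal (x + h) \<le> R i"
          using in_cell \<eta>(3)[OF i] h by (cases rule: R_cases[OF i]) force+
        then have "{x + h - h<..x + h} \<subseteq> cell i"
          using in_cell by (auto simp: cell_def intro: order_trans[of _ "ereal (x + h)"])
        then show ?thesis using mass[of "x + h"] half by linarith
      qed
      then show ?thesis using False q by (auto simp: factor_def)
    next
      case out: False
      then have "Q \<noteq> {0}" "R i = \<infinity>" using j(3) i by (auto simp: covering_def x_def)
      then show ?thesis using nn by (simp add: factor_def q_def)
    qed
  qed
  have "1 / (4 * h) * c \<le> factor j f q * (\<Prod>i\<in>{1..n} - {j}. factor i f q)"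
  proof (rule mult_mono)
    show "1 / (4 * h) \<le> factor j f q" using fx j by (simp add: factor_def x_def)
    have "(\<Prod>i\<in>{1..n} - {j}. 1 / 4) \<le> (\<Prod>i\<in>{1..n} - {j}. factor i f q)"
      using ge by (intro prod_mono) auto
    then show "c \<le> (\<Prod>i\<in>{1..n} - {j}. factor i f q)" using j(1) by (simp add: c_def)
  qed (auto simp: c_def factor_nonneg[OF f])
  also have "\<dots> = lik f q" unfolding lik_def using j(1) by (simp add: prod.remove)
  finally have "c / (4 * h) \<le> lik f q" by simp
  moreover have "\<bar>B\<bar> + 1 \<le> c / (4 * h)" using h(1,4) by (simp add: field_simps)
  ultimately show ?thesis using f q by (intro exI[of _ f] exI[of _ q]) auto
qed

lemma maximizer_exists_iff:
  "(\<exists>g q. subdensity g q \<and> q \<in> Q \<and> (\<forall>f p. subdensity f p \<longrightarrow> p \<in> Q \<longrightarrow> lik f p \<le> lik g q)) \<longleftrightarrow> \<not> degenerate"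
  using maximizer_exists degenerate_unbounded by (meson not_le)

end

section \<open>Log-densities with values in the extended reals\<close>

definition dens :: "(real \<Rightarrow> ereal) \<Rightarrow> real \<Rightarrow> real" where
  "dens \<phi> x = enn2real (exp_ereal (\<phi> x))"

definition elog :: "real \<Rightarrow> ereal" where
  "elog a = ln_ennreal (ennreal a)"

lemma dens_simps:
  "\<phi> x = -\<infinity> \<Longrightarrow> dens \<phi> x = 0" "\<phi> x = ereal y \<Longrightarrow> dens \<phi> x = exp y"
  by (auto simp: dens_def exp_ereal_def)

lemma dens_nonneg: "0 \<le> dens \<phi> x"
  by (simp add: dens_def)

lemma ennreal_dens: "\<phi> x \<noteq> \<infinity> \<Longrightarrow> ennreal (dens \<phi> x) = exp_ereal (\<phi> x)"
  by (cases "\<phi> x") (auto simp: dens_simps exp_ereal_def)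

lemma elog_eq: "0 \<le> a \<Longrightarrow> elog a = (if a = 0 then -\<infinity> else ereal (ln a))"
  by (simp add: elog_def ln_ennreal_def)

lemma elog_dens: "\<phi> x \<noteq> \<infinity> \<Longrightarrow> elog (dens \<phi> x) = \<phi> x"
  by (cases "\<phi> x") (auto simp: dens_simps elog_eq)

lemma dens_elog: "0 \<le> f x \<Longrightarrow> dens (\<lambda>x. elog (f x)) x = f x"
  by (cases "f x = 0") (auto simp: dens_def exp_ereal_def elog_eq)

lemma elog_less_iff: "0 \<le> a \<Longrightarrow> 0 \<le> b \<Longrightarrow> elog a < elog b \<longleftrightarrow> a < b"
  by (auto simp: elog_eq)

text \<open>\<open>elog\<close> never takes the value \<infinity>, so a zero factor turns both sides
  into -\<infinity>.\<close>

lemma sum_elog: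
  assumes "finite A" "\<And>i. i \<in> A \<Longrightarrow> 0 \<le> a i"
  shows "(\<Sum>i\<in>A. elog (a i)) = elog (\<Prod>i\<in>A. a i)"
  using assms
proof (induction rule: finite_induct)
  case (insert i A)
  then have "0 \<le> a i" "0 \<le> (\<Prod>i\<in>A. a i)" by (auto intro: prod_nonneg)
  then have "elog (a i) + elog (\<Prod>i\<in>A. a i) = elog (a i * (\<Prod>i\<in>A. a i))"
    by (auto simp: elog_eq ln_mult)
  then show ?case using insert by simp
qed (simp add: elog_eq)

lemma log_concave_dens_iff:
  assumes fin: "\<And>x. \<phi> x \<noteq> \<infinity>"
  shows "log_concave (dens \<phi>) \<longleftrightarrow> concave_ereal \<phi>"
proof -
  have "dens \<phi> x powr (1 - t) * dens \<phi> y powr t \<le> dens \<phi> z \<longleftrightarrow>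
      ereal (1 - t) * \<phi> x + ereal t * \<phi> y \<le> \<phi> z" if t: "t \<in> {0<..<1}" for x y z t
  proof -
    consider "\<phi> x = -\<infinity>" | "\<phi> y = -\<infinity>" | u v where "\<phi> x = ereal u" "\<phi> y = ereal v"
      using fin[of x] fin[of y] by (cases "\<phi> x"; cases "\<phi> y") auto
    then show ?thesis
    proof cases
      case 1
      then show ?thesis using t fin[of y] by (cases "\<phi> y") (auto simp: dens_simps dens_nonneg)
    next
      case 2
      then show ?thesis using t fin[of x] by (cases "\<phi> x") (auto simp: dens_simps dens_nonneg)
    next
      case 3
      then have "dens \<phi> x powr (1 - t) * dens \<phi> y powr t = exp ((1 - t) * u + t * v)"
        by (simp add: dens_simps exp_powr_real exp_add mult.commute)
      then show ?thesis using 3 fin[of z]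
        by (cases "\<phi> z") (auto simp: dens_simps not_le)
    qed
  qed
  then show ?thesis unfolding log_concave_def concave_ereal_def by blast
qed

text \<open>Positive levels correspond through \<open>exp\<close>, and levels
  \<open>c \<le> 0\<close> are vacuous for \<open>dens \<phi>\<close>. The punctured filter of
  \<open>Limsup\<close> may replace \<open>nhds\<close> because the strict inequality holds at
  \<open>x\<close> itself.\<close>

lemma usc_dens_iff:
  assumes fin: "\<And>x. \<phi> x \<noteq> \<infinity>"
  shows "usc (dens \<phi>) \<longleftrightarrow> upper_semicontinuous \<phi>"
proof -
  have exp_less: "dens \<phi> y < exp c \<longleftrightarrow> \<phi> y < ereal c" for y c
    using fin[of y] by (cases "\<phi> y") (auto simp: dens_simps)
  have "(\<forall>c. dens \<phi> x < c \<longrightarrow> (\<forall>\<^sub>F y in nhds x. dens \<phi> y < c)) \<longleftrightarrow>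
      (\<forall>c. \<phi> x < c \<longrightarrow> (\<forall>\<^sub>F y in at x. \<phi> y < c))" (is "?l \<longleftrightarrow> ?r") for x
  proof
    assume ?l
    show ?r
    proof (intro allI impI)
      fix c assume c: "\<phi> x < c"
      show "\<forall>\<^sub>F y in at x. \<phi> y < c"
      proof (cases c)
        case (real u)
        then have "\<forall>\<^sub>F y in nhds x. dens \<phi> y < exp u" using c \<open>?l\<close> exp_less by blast
        then have "\<forall>\<^sub>F y in nhds x. \<phi> y < c" unfolding exp_less real .
        then show ?thesis by (auto simp: eventually_at_filter elim: eventually_mono)
      qed (use fin c in simp_all)
    qed
  next
    assume ?r
    show ?l
    proof (intro allI impI)
      fix c assume c: "dens \<phi> x < c"
      then have "0 < c" using dens_nonneg[of \<phi> x] by linarith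
      then have eq: "c = exp (ln c)" by simp
      have "\<phi> x < ereal (ln c)" using c exp_less[of x "ln c"] \<open>0 < c\<close> by simp
      moreover from this have "\<forall>\<^sub>F y in at x. \<phi> y < ereal (ln c)" using \<open>?r\<close> by blast
      ultimately have "\<forall>\<^sub>F y in nhds x. \<phi> y < ereal (ln c)"
        by (simp add: eventually_nhds_conv_at)
      then show "\<forall>\<^sub>F y in nhds x. dens \<phi> y < c" by (subst eq) (simp only: exp_less)
    qed
  qed
  then show ?thesis unfolding usc_def upper_semicontinuous_def Limsup_le_iff by blast
qed

text \<open>Semicontinuity comes first in the case split: it makes \<open>dens \<phi>\<close>
  measurable, so that the nonnegative integral can be identified with the Lebesgue integral. In the
  remaining case both sides are false.\<close>

lemma Theta_iff: "(\<phi>, q) \<in> Theta \<longleftrightarrow> (\<forall>x. \<phi> x \<noteq> \<infinity>) \<and> subdensity (dens \<phi>) q"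
proof (cases "(\<forall>x. \<phi> x \<noteq> \<infinity>) \<and> usc (dens \<phi>) \<and> 0 \<le> q \<and> q < 1")
  case True
  then have fin: "\<And>x. \<phi> x \<noteq> \<infinity>" and q: "0 \<le> q" "q < 1" by auto
  have [measurable]: "dens \<phi> \<in> borel_measurable borel" using True usc_borel_measurable by blast
  have "(\<integral>\<^sup>+x. exp_ereal (\<phi> x) \<partial>lborel) + ennreal q = 1 \<longleftrightarrow>
      (\<integral>\<^sup>+x. ennreal (dens \<phi> x) \<partial>lborel) + ennreal q = ennreal (1 - q) + ennreal q"
    using q fin by (simp add: ennreal_dens flip: ennreal_plus)
  also have "\<dots> \<longleftrightarrow> (\<integral>\<^sup>+x. ennreal (dens \<phi> x) \<partial>lborel) = ennreal (1 - q)"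
    by (simp add: add.commute[of _ "ennreal q"] ennreal_add_left_cancel)
  also have "\<dots> \<longleftrightarrow> integrable lborel (dens \<phi>) \<and> integral\<^sup>L lborel (dens \<phi>) = 1 - q"
    using q by (intro nn_integral_eq_integrable) (auto simp: dens_nonneg)
  finally show ?thesis
    using True log_concave_dens_iff[of \<phi>] usc_dens_iff[of \<phi>]
    by (auto simp: Theta_def subdensity_def dens_nonneg)
next
  case False
  then show ?thesis using usc_dens_iff[of \<phi>] by (auto simp: Theta_def subdensity_def)
qed

lemma subdensity_Theta:
  assumes "subdensity f q"
  shows "((\<lambda>x. elog (f x)), q) \<in> Theta" "dens (\<lambda>x. elog (f x)) = f"
proof -
  show *: "dens (\<lambda>x. elog (f x)) = f"
    by (rule ext) (simp add: dens_elog subdensity.nonneg[OF assms])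
  have "elog (f x) \<noteq> \<infinity>" for x by (simp add: elog_eq subdensity.nonneg[OF assms])
  then show "((\<lambda>x. elog (f x)), q) \<in> Theta" using assms unfolding Theta_iff * by blast
qed

section \<open>Transfer from the likelihood of densities to the log-likelihood\<close>

context censored_sample
begin

lemma loglik_eq:
  assumes \<phi>: "(\<phi>, q) \<in> Theta"
  shows "loglik n L R \<phi> q = ereal (1 / real n) * elog (lik (dens \<phi>) q)"
proof -
  have fin: "\<And>x. \<phi> x \<noteq> \<infinity>" and sub: "subdensity (dens \<phi>) q" using \<phi> by (auto simp: Theta_iff)
  interpret subdensity "dens \<phi>" q by (rule sub)
  have P: "P_meas \<phi> q {ereal (L i)<..R i} = ennreal (factor i (dens \<phi>) q)"
    if "i \<in> {1..n}" "ereal (L i) \<noteq> R i" for i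
  proof -
    have "(\<integral>\<^sup>+x \<in> {x. ereal x \<in> {ereal (L i)<..R i}}. exp_ereal (\<phi> x) \<partial>lborel) =
        (\<integral>\<^sup>+x. ennreal (indicator (cell i) x *\<^sub>R dens \<phi> x) \<partial>lborel)"
      by (intro nn_integral_cong) (auto simp: cell_def fin ennreal_dens split: split_indicator)
    also have "\<dots> = ennreal (LINT x:cell i|lborel. dens \<phi> x)"
      unfolding set_lebesgue_integral_def
      using set_integrable[of "cell i"] by (intro nn_integral_eq_integral) (auto simp: set_integrable_def nonneg)
    moreover have "ennreal q * indicator {ereal (L i)<..R i} \<infinity> = ennreal (if R i = \<infinity> then q else 0)"
      using q_nonneg by (auto simp: indicator_def)
    ultimately show ?thesis
      using that q_nonneg set_integral_nonneg[of "cell i"]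
      by (simp add: P_meas_def factor_def flip: ennreal_plus)
  qed
  have "(\<Sum>i=1..n. if ereal (L i) = R i then \<phi> (L i) else ln_ennreal (P_meas \<phi> q {ereal (L i)<..R i})) =
      (\<Sum>i=1..n. elog (factor i (dens \<phi>) q))"
  proof (rule sum.cong[OF refl])
    fix i assume i: "i \<in> {1..n}"
    show "(if ereal (L i) = R i then \<phi> (L i) else ln_ennreal (P_meas \<phi> q {ereal (L i)<..R i})) =
        elog (factor i (dens \<phi>) q)"
    proof (cases "ereal (L i) = R i")
      case True
      then show ?thesis by (simp add: factor_def elog_dens fin)
    qed (simp add: P[OF i] elog_def)
  qed
  also have "\<dots> = elog (lik (dens \<phi>) q)"
    unfolding lik_def by (intro sum_elog) (auto simp: factor_nonneg sub)
  finally show ?thesis by (simp add: loglik_def)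
qed

lemma loglik_less_iff:
  assumes "(\<phi>, q) \<in> Theta" "(\<psi>, p) \<in> Theta"
  shows "loglik n L R \<phi> q < loglik n L R \<psi> p \<longleftrightarrow> lik (dens \<phi>) q < lik (dens \<psi>) p"
proof -
  have nn: "0 \<le> lik (dens \<phi>) q" "0 \<le> lik (dens \<psi>) p" using assms by (auto simp: Theta_iff lik_nonneg)
  have "loglik n L R \<phi> q < loglik n L R \<psi> p \<longleftrightarrow> elog (lik (dens \<phi>) q) < elog (lik (dens \<psi>) p)"
    unfolding loglik_eq[OF assms(1)] loglik_eq[OF assms(2)]
    using nn n_pos by (auto simp: elog_eq divide_less_cancel)
  then show ?thesis using nn by (simp add: elog_less_iff)
qed

text \<open>Maximality is phrased by a negated strict inequality to fit
  \<open>is_arg_max\<close>.\<close>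

lemma loglik_maximizer_iff:
  "(\<exists>\<phi> q. (\<phi>, q) \<in> Theta \<and> q \<in> Q \<and>
      (\<forall>\<psi> p. (\<psi>, p) \<in> Theta \<longrightarrow> p \<in> Q \<longrightarrow> \<not> loglik n L R \<phi> q < loglik n L R \<psi> p)) \<longleftrightarrow> \<not> degenerate"
  (is "?l \<longleftrightarrow> _")
proof -
  have "?l \<longleftrightarrow> (\<exists>g q. subdensity g q \<and> q \<in> Q \<and> (\<forall>f p. subdensity f p \<longrightarrow> p \<in> Q \<longrightarrow> lik f p \<le> lik g q))"
    (is "_ \<longleftrightarrow> ?r")
  proof
    assume ?l
    then obtain \<phi> q where \<phi>: "(\<phi>, q) \<in> Theta" "q \<in> Q"
      and max: "\<And>\<psi> p. (\<psi>, p) \<in> Theta \<Longrightarrow> p \<in> Q \<Longrightarrow> \<not> loglik n L R \<phi> q < loglik n L R \<psi> p" by blast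
    have "lik f p \<le> lik (dens \<phi>) q" if "subdensity f p" "p \<in> Q" for f p
      using max[OF subdensity_Theta(1)[OF that(1)] that(2)] loglik_less_iff[OF \<phi>(1) subdensity_Theta(1)[OF that(1)]]
      by (simp add: subdensity_Theta(2)[OF that(1)] not_less)
    then show ?r using \<phi> by (auto simp: Theta_iff)
  next
    assume ?r
    then obtain g q where g: "subdensity g q" "q \<in> Q"
      and max: "\<And>f p. subdensity f p \<Longrightarrow> p \<in> Q \<Longrightarrow> lik f p \<le> lik g q" by blast
    have "\<not> loglik n L R (\<lambda>x. elog (g x)) q < loglik n L R \<psi> p" if \<psi>: "(\<psi>, p) \<in> Theta" "p \<in> Q" for \<psi> p
      using \<psi> max[of "dens \<psi>" p]
      by (simp add: loglik_less_iff[OF subdensity_Theta(1)[OF g(1)] \<psi>(1)] subdensity_Theta(2)[OF g(1)]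
          Theta_iff not_less)
    then show ?l using subdensity_Theta(1)[OF g(1)] g(2) by blast
  qed
  then show ?thesis by (simp add: maximizer_exists_iff)
qed

end

theorem theorem2p1:
  fixes n :: nat and X :: "nat \<Rightarrow> ereal set" and L :: "nat \<Rightarrow> real" and R :: "nat \<Rightarrow> ereal"
  assumes "n \<ge> 1"
    and "\<And>i. i \<in> {1..n} \<Longrightarrow> censored (X i) (L i) (R i) \<or> uncensored (X i) (L i) (R i)"
  shows "((\<exists>\<phi>. is_arg_max (\<lambda>\<phi>. loglik n L R \<phi> 0) (\<lambda>\<phi>. \<phi> \<in> Phi 0) \<phi>) \<longleftrightarrow>
           \<not> (\<exists>i\<^sub>o\<in>{1..n}. \<exists>x. X i\<^sub>o = {ereal x} \<and>
                (\<forall>i\<in>{1..n}. ereal x \<in> {ereal (L i)..R i}))) \<and>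
         ((\<exists>\<phi> q. is_arg_max (\<lambda>(\<phi>, q). loglik n L R \<phi> q) (\<lambda>(\<phi>, q). (\<phi>, q) \<in> Theta) (\<phi>, q)) \<longleftrightarrow>
           \<not> (\<exists>i\<^sub>o\<in>{1..n}. \<exists>x. X i\<^sub>o = {ereal x} \<and>
                (\<forall>i\<in>{1..n}. ereal x \<in> {ereal (L i)..R i} \<or> \<infinity> \<in> {ereal (L i)..R i})))"
proof -
  have LR: "ereal (L i) \<le> R i" if "i \<in> {1..n}" for i
    using assms(2)[OF that] unfolding censored_def uncensored_def by (metis less_imp_le order_refl)
  have single: "X i = {ereal x} \<longleftrightarrow> ereal (L i) = R i \<and> x = L i" if i: "i \<in> {1..n}" for i x
    using assms(2)[OF i]
  proof
    assume c: "censored (X i) (L i) (R i)"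
    \<comment> \<open>A nonempty half-open interval contains two different reals, so a censored
      observation is never a singleton.\<close>
    then obtain y where y: "ereal (L i) < ereal y" "ereal y < R i"
      using ereal_dense2[of "ereal (L i)" "R i"] unfolding censored_def by auto
    obtain z where z: "ereal (L i) < ereal z" "ereal z < ereal y"
      using ereal_dense2[OF y(1)] by auto
    have "ereal y \<in> X i" "ereal z \<in> X i"
      using c y z less_imp_le[OF y(2)] order_trans[OF less_imp_le[OF z(2)] less_imp_le[OF y(2)]]
      by (simp_all add: censored_def)
    then have "X i \<noteq> {ereal x}" using z(2) by fastforce
    moreover have "ereal (L i) \<noteq> R i" using c unfolding censored_def by (metis less_irrefl)
    ultimately show ?thesis by blast
  next
    assume "uncensored (X i) (L i) (R i)"
    then have "ereal (L i) = R i" "X i = {ereal (L i)}" unfolding uncensored_def by blast+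
    moreover have "{ereal (L i)} = {ereal x} \<longleftrightarrow> x = L i" by auto
    ultimately show ?thesis by simp
  qed
  have singleton: "(\<exists>x. X i = {ereal x} \<and> P x) \<longleftrightarrow> ereal (L i) = R i \<and> P (L i)" if "i \<in> {1..n}" for i P
    unfolding single[OF that] by blast
  have infinite: "\<infinity> \<in> {ereal (L i)..R i} \<longleftrightarrow> R i = \<infinity>" for i
    by simp
  interpret a: censored_sample n L R "{0}"
    by unfold_locales (use assms(1) LR in auto)
  interpret b: censored_sample n L R "{0..<1}"
    by unfold_locales (use assms(1) LR in auto)
  \<comment> \<open>With \<open>Q \<noteq> {0}\<close> established, the second alternative in
    \<open>covering\<close> reduces to \<open>R i = \<infinity>\<close>.\<close>
  have "1 / 2 \<in> {0..<1::real}" by simp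
  then have ne: "{0..<1::real} \<noteq> {0}" by force
  show ?thesis
  proof
    have "(\<exists>\<phi>. is_arg_max (\<lambda>\<phi>. loglik n L R \<phi> 0) (\<lambda>\<phi>. \<phi> \<in> Phi 0) \<phi>) \<longleftrightarrow> \<not> a.degenerate"
      using a.loglik_maximizer_iff by (simp add: is_arg_max_def Phi_def)
    also have "a.degenerate \<longleftrightarrow> (\<exists>i\<^sub>o\<in>{1..n}. \<exists>x. X i\<^sub>o = {ereal x} \<and>
                (\<forall>i\<in>{1..n}. ereal x \<in> {ereal (L i)..R i}))"
      unfolding a.degenerate_def a.covering_def by (intro bex_cong refl) (simp only: singleton simp_thms)
    finally show "(\<exists>\<phi>. is_arg_max (\<lambda>\<phi>. loglik n L R \<phi> 0) (\<lambda>\<phi>. \<phi> \<in> Phi 0) \<phi>) \<longleftrightarrow>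
        \<not> (\<exists>i\<^sub>o\<in>{1..n}. \<exists>x. X i\<^sub>o = {ereal x} \<and> (\<forall>i\<in>{1..n}. ereal x \<in> {ereal (L i)..R i}))" .
    have Theta_Q: "(\<phi>, q) \<in> Theta \<and> q \<in> {0..<1} \<longleftrightarrow> (\<phi>, q) \<in> Theta" for \<phi> q
      by (auto simp: Theta_def)
    have "(\<exists>\<phi> q. is_arg_max (\<lambda>(\<phi>, q). loglik n L R \<phi> q) (\<lambda>(\<phi>, q). (\<phi>, q) \<in> Theta) (\<phi>, q)) \<longleftrightarrow>
        (\<exists>\<phi> q. ((\<phi>, q) \<in> Theta \<and> q \<in> {0..<1}) \<and>
          (\<forall>\<psi> p. (\<psi>, p) \<in> Theta \<and> p \<in> {0..<1} \<longrightarrow> \<not> loglik n L R \<phi> q < loglik n L R \<psi> p))"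
      unfolding Theta_Q is_arg_max_def by simp
    also have "\<dots> \<longleftrightarrow> \<not> b.degenerate"
      using b.loglik_maximizer_iff by (simp only: imp_conjL conj_assoc)
    also have "b.degenerate \<longleftrightarrow> (\<exists>i\<^sub>o\<in>{1..n}. \<exists>x. X i\<^sub>o = {ereal x} \<and>
                (\<forall>i\<in>{1..n}. ereal x \<in> {ereal (L i)..R i} \<or> \<infinity> \<in> {ereal (L i)..R i}))"
      unfolding b.degenerate_def b.covering_def
      by (intro bex_cong refl) (simp only: singleton infinite ne simp_thms)
    finally show "(\<exists>\<phi> q. is_arg_max (\<lambda>(\<phi>, q). loglik n L R \<phi> q) (\<lambda>(\<phi>, q). (\<phi>, q) \<in> Theta) (\<phi>, q)) \<longleftrightarrow>
        \<not> (\<exists>i\<^sub>o\<in>{1..n}. \<exists>x. X i\<^sub>o = {ereal x} \<and>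
                (\<forall>i\<in>{1..n}. ereal x \<in> {ereal (L i)..R i} \<or> \<infinity> \<in> {ereal (L i)..R i}))" .
  qed
qed

end
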